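(* Let $A\in\mathbb{Z}^{d\times n}$ have rank $d$ with columns lying in an affine hyperplane of $\mathbb{Q}^d$ not containing the origin, let $\beta\in\mathbb{C}^d$, let $w\in\mathbb{R}^n$ be a generic weight vector, and let $v$ be a fake exponent of $H_A(\beta)$ with respect to $w$. Put $I_0=\operatorname{nsupp}(v)=\{i_1,\ldots,i_k\}$, $k=|I_0|$, $V=[n]\setminus I_0$. Let $L_1,\ldots,L_k,\ell_1,\ldots,\ell_{d-k}$ be linear forms in the variables $\theta_V=(\theta_j)_{j\in V}$ such that $\langle A\theta\rangle$ is generated by $$\theta_{i_1}-L_1(\theta_V),\ldots,\theta_{i_k}-L_k(\theta_V),\ \ell_1(\theta_V),\ldots,\ell_{d-k}(\theta_V).$$ Then, under $\theta_j\mapsto x_j$ for $j\in V$, the forms $\ell_1,\ldots,\ell_{d-|I_0|}$ define elements of $\mathbb{C}[\operatorname{link}_v]$, and there is a degree-preserving isomorphism $$T/Q_v\cong\mathbb{C}[\operatorname{link}_v]/(\ell_1,\ldots,\ell_{d-|I_0|}).$$ If moreover $\mathcal{S}_w(v)$ contains a top-dimensional standard pair, then $$d-|I_0|=\dim\mathbb{C}[\operatorname{link}_v]=\dim\operatorname{link}_v+1.$$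
   Context: Notation: $\mathbb{N}=\{0,1,2,\ldots\}$, $[n]=\{1,\ldots,n\}$, $L=\ker_{\mathbb{Z}}(A)=\{u\in\mathbb{Z}^n\mid Au=0\}$. The toric ideal is $I_A=\langle\partial^u-\partial^{u'}\mid Au=Au',\ u,u'\in\mathbb{N}^n\rangle\subseteq\mathbb{C}[\partial_1,\ldots,\partial_n]$. For $w\in\mathbb{R}^n$, $\operatorname{in}_w(I_A)$ is the ideal generated by the $w$-initial forms (sums of terms of maximal $w$-weight) of elements of $I_A$; "$w$ generic" means in particular that $\operatorname{in}_w(I_A)$ is a monomial ideal. Let $D=\mathbb{C}\langle x_1,\ldots,x_n,\partial_1,\ldots,\partial_n\rangle$ be the Weyl algebra and $\vartheta_j=x_j\partial_j$. $H_A(\beta)$ is the left ideal of $D$ generated by $I_A$ and the Euler operators $\sum_j a_{ij}\vartheta_j-\beta_i$ ($i=1,\ldots,d$). The fake indicial ideal is $(D\cdot\operatorname{in}_w(I_A)\cap\mathbb{C}[\vartheta])+\langle A\vartheta-\beta\rangle\subseteq\mathbb{C}[\vartheta]$; a zero $v\in\mathbb{C}^n$ of it is called a fake exponent of $H_A(\beta)$ with respect to $w$. The negative support of $z\in\mathbb{C}^n$ is $\operatorname{nsupp}(z)=\{j\in[n]\mid z_j\in\mathbb{Z}_{<0}\}$. For $u\in L$ put $I_u=\operatorname{nsupp}(v+u)$, so $I_0=\operatorname{nsupp}(v)$. A standard pair of a monomial ideal $M\subseteq\mathbb{C}[\partial]$ is a pair $(a,\sigma)$, $a\in\mathbb{N}^n$,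 $\sigma\subseteq[n]$, such that (i) $a_i=0$ for $i\in\sigma$; (ii) $\partial^a\prod_{j\in\sigma}\partial_j^{b_j}\notin M$ for all $b_j\in\mathbb{N}$; (iii) for every $\ell\notin\sigma$ there are $b_j\in\mathbb{N}$ ($j\in\sigma\cup\{\ell\}$) with $\partial^a\prod_{j\in\sigma\cup\{\ell\}}\partial_j^{b_j}\in M$. $\mathcal{S}(M)$ is the set of standard pairs. A standard pair of $\operatorname{in}_w(I_A)$ is top-dimensional if $|\sigma|=d$. Put $\mathcal{S}_w(v)=\{(a,\sigma)\in\mathcal{S}(\operatorname{in}_w(I_A))\mid v_j=a_j\text{ for every }j\notin\sigma\}$. (Known criterion: $v$ is a fake exponent iff $Av=\beta$ and $\mathcal{S}_w(v)\neq\emptyset$.) $\Delta_w(v)=\{\tau\subseteq[n]\mid\tau\subseteq\sigma\text{ for some }(a,\sigma)\in\mathcal{S}_w(v)\}$, and $\operatorname{link}_v=\{\tau\in\Delta_w(v)\mid\tau\cap I_0=\emptyset,\ \tau\cup I_0\in\Delta_w(v)\}$, a simplicial complex regarded on the vertex set $V=[n]\setminus I_0$ (some elements of $V$ may be nonfaces). For a simplicial complex $\Delta$ on $V$, $I_\Delta=\langle\prod_{i\in\tau}x_i\mid\tau\subseteq V,\ \tau\notin\Delta\rangle$ and $\mathbb{C}[\Delta]=\mathbb{C}[x_i\mid i\in V]/I_\Delta$. Let $\{\partial^{g_+^{(i)}}-\partial^{g_-^{(i)}}\mid i=1,\ldots,m\}$ be the reduced Gröbner basis of $I_A$ with respect to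 $w$, with $\partial^{g_+^{(i)}}\in\operatorname{in}_w(I_A)$; put $g^{(i)}=g_+^{(i)}-g_-^{(i)}$ and $G^{(i)}=I_{-g^{(i)}}\setminus I_0$. Let $T=\mathbb{C}[\theta_1,\ldots,\theta_n]$ (standard grading), $\langle A\theta\rangle=\langle\sum_j a_{ij}\theta_j\mid i=1,\ldots,d\rangle$, $M_\theta(v)=\langle\prod_{j\in G^{(i)}}\theta_j\mid i=1,\ldots,m\rangle$, and $Q_v=\langle A\theta\rangle+M_\theta(v)\subseteq T$. Linear forms $L_p,\ell_q$ as in the claim exist, by row reduction of $A\theta$. *)

theory Defs
  imports "HOL-Analysis.Analysis" "HOL-Algebra.QuotRing" "HOL-Library.Poly_Mapping"
begin

section \<open>Polynomial rings\<close>

text \<open>The same type serves for polynomials in the commuting symbols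
  \<open>\<partial>\<^sub>j\<close>, \<open>\<theta>\<^sub>j\<close>, \<open>x\<^sub>j\<close>; exponent vectors in \<open>\<nat>\<^sup>n\<close> are elements of \<open>'n \<Rightarrow>\<^sub>0 nat\<close>.\<close>

type_synonym 'n mpol = "('n \<Rightarrow>\<^sub>0 nat) \<Rightarrow>\<^sub>0 complex"

abbreviation lookup :: "('a \<Rightarrow>\<^sub>0 'b::zero) \<Rightarrow> 'a \<Rightarrow> 'b"
  where "lookup \<equiv> Poly_Mapping.lookup"

abbreviation keys :: "('a \<Rightarrow>\<^sub>0 'b::zero) \<Rightarrow> 'a set"
  where "keys \<equiv> Poly_Mapping.keys"

definition pconst :: "complex \<Rightarrow> 'n mpol"
  where "pconst c = Poly_Mapping.single 0 c"

definition pmon :: "('n \<Rightarrow>\<^sub>0 nat) \<Rightarrow> 'n mpol"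
  where "pmon u = Poly_Mapping.single u 1"

definition pvar :: "'n \<Rightarrow> 'n mpol"
  where "pvar j = pmon (Poly_Mapping.single j 1)"

definition peval :: "complex^'n \<Rightarrow> 'n mpol \<Rightarrow> complex"
  where "peval v p = (\<Sum>u\<in>keys p. lookup p u * (\<Prod>j\<in>UNIV. (v $ j) ^ lookup u j))"

definition poly_ring :: "'n set \<Rightarrow> 'n mpol ring"
  where "poly_ring V =
    \<lparr>carrier = {p. \<forall>u\<in>keys p. keys u \<subseteq> V}, mult = (*), one = 1, zero = 0, add = (+)\<rparr>"

text \<open>The homogeneous polynomials of degree \<open>m\<close> for the standard grading, including \<open>0\<close>.\<close>

definition homog_part :: "'n::finite set \<Rightarrow> nat \<Rightarrow> 'n mpol set"
  where "homog_part V m =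
    {p \<in> carrier (poly_ring V). \<forall>u\<in>keys p. (\<Sum>j\<in>UNIV. lookup u j) = m}"

definition linear_form_in :: "'n::finite set \<Rightarrow> 'n mpol \<Rightarrow> bool"
  where "linear_form_in V p \<longleftrightarrow> (\<exists>c. p = (\<Sum>j\<in>V. pconst (c j) * pvar j))"

lemma poly_ring_simps [simp]:
  "p \<in> carrier (poly_ring V) \<longleftrightarrow> (\<forall>u\<in>keys p. keys u \<subseteq> V)"
  "\<zero>\<^bsub>poly_ring V\<^esub> = 0" "\<one>\<^bsub>poly_ring V\<^esub> = 1"
  "p \<oplus>\<^bsub>poly_ring V\<^esub> q = p + q" "p \<otimes>\<^bsub>poly_ring V\<^esub> q = p * q"
  by (simp_all add: poly_ring_def)

lemma cring_poly_ring: "cring (poly_ring V)"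
proof (rule cringI)
  show "abelian_group (poly_ring V)"
  proof (rule abelian_groupI)
    fix p q assume "p \<in> carrier (poly_ring V)" "q \<in> carrier (poly_ring V)"
    then show "p \<oplus>\<^bsub>poly_ring V\<^esub> q \<in> carrier (poly_ring V)"
      using Poly_Mapping.keys_add[of p q] by auto
  next
    fix p assume "p \<in> carrier (poly_ring V)"
    then show "\<exists>q\<in>carrier (poly_ring V). q \<oplus>\<^bsub>poly_ring V\<^esub> p = \<zero>\<^bsub>poly_ring V\<^esub>"
      by (intro bexI[of _ "- p"]) auto
  qed (auto simp: ac_simps)
next
  show "Group.comm_monoid (poly_ring V)"
  proof (rule comm_monoidI)
    fix p q assume *: "p \<in> carrier (poly_ring V)" "q \<in> carrier (poly_ring V)"
    have "keys u \<subseteq> V" if u: "u \<in> keys (p * q)" for u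
    proof -
      obtain a b where "u = a + b" "a \<in> keys p" "b \<in> keys q"
        using u Poly_Mapping.keys_mult[of p q] by blast
      then show ?thesis using * Poly_Mapping.keys_add[of a b] by simp blast
    qed
    then show "p \<otimes>\<^bsub>poly_ring V\<^esub> q \<in> carrier (poly_ring V)" by simp
  qed (auto simp: ac_simps)
qed (auto simp: algebra_simps)

section \<open>Toric ideals, initial ideals, Groebner bases\<close>

definition mat_exp :: "int^'n^'d \<Rightarrow> ('n::finite \<Rightarrow>\<^sub>0 nat) \<Rightarrow> int^'d"
  where "mat_exp A u = (\<chi> i. \<Sum>j\<in>UNIV. A $ i $ j * int (lookup u j))"

definition toric_ideal :: "int^'n^'d \<Rightarrow> 'n::finite mpol set"
  where "toric_ideal A =
    Idl\<^bsub>poly_ring UNIV\<^esub> {pmon u - pmon u' | u u'. mat_exp A u = mat_exp A u'}"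

definition weight :: "real^'n \<Rightarrow> ('n::finite \<Rightarrow>\<^sub>0 nat) \<Rightarrow> real"
  where "weight w u = (\<Sum>j\<in>UNIV. w $ j * real (lookup u j))"

definition initial_form :: "real^'n \<Rightarrow> 'n::finite mpol \<Rightarrow> 'n mpol"
  where "initial_form w p =
    (\<Sum>u\<in>{u\<in>keys p. \<forall>u'\<in>keys p. weight w u' \<le> weight w u}. Poly_Mapping.single u (lookup p u))"

definition initial_ideal :: "real^'n \<Rightarrow> 'n::finite mpol set \<Rightarrow> 'n mpol set"
  where "initial_ideal w I = Idl\<^bsub>poly_ring UNIV\<^esub> (initial_form w ` I)"

definition monomial_ideal :: "'n::finite mpol set \<Rightarrow> bool"
  where "monomial_ideal M \<longleftrightarrow> (\<exists>E. M = Idl\<^bsub>poly_ring UNIV\<^esub> (pmon ` E))"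

definition generic_weight :: "int^'n^'d \<Rightarrow> real^'n::finite \<Rightarrow> bool"
  where "generic_weight A w \<longleftrightarrow> monomial_ideal (initial_ideal w (toric_ideal A))"

text \<open>Meant for weights \<open>w\<close> with monomial initial ideal, so that no tie-breaking term order is
  needed and the \<open>w\<close>-initial forms of the basis elements are their leading terms.\<close>

definition reduced_groebner_basis ::
    "real^'n \<Rightarrow> 'n::finite mpol set \<Rightarrow> 'n mpol set \<Rightarrow> bool"
  where "reduced_groebner_basis w I G \<longleftrightarrow>
    finite G \<and> G \<subseteq> I \<and>
    I = Idl\<^bsub>poly_ring UNIV\<^esub> G \<and>
    initial_ideal w I = Idl\<^bsub>poly_ring UNIV\<^esub> (initial_form w ` G) \<and>
    (\<forall>g\<in>G. \<exists>u. initial_form w g = pmon u) \<and>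
    (\<forall>g\<in>G. \<forall>u\<in>keys g. pmon u \<notin> Idl\<^bsub>poly_ring UNIV\<^esub> (initial_form w ` (G - {g})))"

section \<open>The Weyl algebra and fake exponents\<close>

text \<open>The Weyl algebra is realised as the algebra of differential operators with polynomial
  coefficients, i.e. as the subalgebra of the linear endomorphisms of \<open>\<complex>[x]\<close> generated by
  the multiplications \<open>x\<^sub>j\<close> and the partial derivatives \<open>\<partial>\<^sub>j\<close>. The product is composition.\<close>

definition x_op :: "'n \<Rightarrow> 'n mpol \<Rightarrow> 'n mpol"
  where "x_op j f = pvar j * f"

definition d_op :: "'n \<Rightarrow> 'n mpol \<Rightarrow> 'n mpol"
  where "d_op j f =
    (\<Sum>u\<in>keys f. Poly_Mapping.single (u - Poly_Mapping.single j 1) (of_nat (lookup u j) * lookup f u))"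

definition vartheta_op :: "'n \<Rightarrow> 'n mpol \<Rightarrow> 'n mpol"
  where "vartheta_op j = x_op j \<circ> d_op j"

inductive_set weyl_algebra :: "('n mpol \<Rightarrow> 'n mpol) set" where
  scalar: "(\<lambda>f. pconst c * f) \<in> weyl_algebra"
| x: "x_op j \<in> weyl_algebra"
| d: "d_op j \<in> weyl_algebra"
| add: "P \<in> weyl_algebra \<Longrightarrow> Q \<in> weyl_algebra \<Longrightarrow> (\<lambda>f. P f + Q f) \<in> weyl_algebra"
| mult: "P \<in> weyl_algebra \<Longrightarrow> Q \<in> weyl_algebra \<Longrightarrow> P \<circ> Q \<in> weyl_algebra"

inductive_set weyl_left_ideal :: "('n mpol \<Rightarrow> 'n mpol) set \<Rightarrow> ('n mpol \<Rightarrow> 'n mpol) set"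
  for S where
  zero: "(\<lambda>f. 0) \<in> weyl_left_ideal S"
| step: "P \<in> weyl_algebra \<Longrightarrow> s \<in> S \<Longrightarrow> Q \<in> weyl_left_ideal S \<Longrightarrow>
    (\<lambda>f. P (s f) + Q f) \<in> weyl_left_ideal S"

text \<open>Substitution of pairwise commuting operators \<open>F\<^sub>j\<close> for the variables of a polynomial;
  for \<open>F = d_op\<close> and \<open>F = vartheta_op\<close> these are the embeddings of \<open>\<complex>[\<partial>]\<close> and
  \<open>\<complex>[\<vartheta>]\<close> into the Weyl algebra.\<close>

definition op_monomial :: "('n::finite \<Rightarrow> 'n mpol \<Rightarrow> 'n mpol) \<Rightarrow> ('n \<Rightarrow>\<^sub>0 nat) \<Rightarrow> 'n mpol \<Rightarrow> 'n mpol"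
  where "op_monomial F u = Finite_Set.fold (\<lambda>j P. (F j ^^ lookup u j) \<circ> P) id UNIV"

definition op_subst :: "('n::finite \<Rightarrow> 'n mpol \<Rightarrow> 'n mpol) \<Rightarrow> 'n mpol \<Rightarrow> 'n mpol \<Rightarrow> 'n mpol"
  where "op_subst F p = (\<lambda>f. \<Sum>u\<in>keys p. pconst (lookup p u) * op_monomial F u f)"

definition fake_indicial_ideal ::
    "int^'n^'d \<Rightarrow> complex^'d \<Rightarrow> real^'n \<Rightarrow> 'n::finite mpol set"
  where "fake_indicial_ideal A \<beta> w =
    {p. op_subst vartheta_op p \<in>
          weyl_left_ideal (op_subst d_op ` initial_ideal w (toric_ideal A))}
    <+>\<^bsub>poly_ring UNIV\<^esub>
    Idl\<^bsub>poly_ring UNIV\<^esub>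
      (range (\<lambda>i. (\<Sum>j\<in>UNIV. pconst (of_int (A $ i $ j)) * pvar j) - pconst (\<beta> $ i)))"

definition fake_exponent ::
    "int^'n^'d \<Rightarrow> complex^'d \<Rightarrow> real^'n \<Rightarrow> complex^'n::finite \<Rightarrow> bool"
  where "fake_exponent A \<beta> w v \<longleftrightarrow> (\<forall>p\<in>fake_indicial_ideal A \<beta> w. peval v p = 0)"

section \<open>Standard pairs and the link\<close>

definition nsupp :: "complex^'n \<Rightarrow> 'n set"
  where "nsupp z = {j. \<exists>k::int. k < 0 \<and> z $ j = of_int k}"

definition standard_pairs :: "'n::finite mpol set \<Rightarrow> (('n \<Rightarrow>\<^sub>0 nat) \<times> 'n set) set"
  where "standard_pairs M = {(a, \<sigma>).
    (\<forall>i\<in>\<sigma>. lookup a i = 0) \<and>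
    (\<forall>b. keys b \<subseteq> \<sigma> \<longrightarrow> pmon (a + b) \<notin> M) \<and>
    (\<forall>l. l \<notin> \<sigma> \<longrightarrow> (\<exists>b. keys b \<subseteq> insert l \<sigma> \<and> pmon (a + b) \<in> M))}"

definition std_pairs_at ::
    "int^'n^'d \<Rightarrow> real^'n \<Rightarrow> complex^'n::finite \<Rightarrow> (('n \<Rightarrow>\<^sub>0 nat) \<times> 'n set) set"
  where "std_pairs_at A w v = {(a, \<sigma>) \<in> standard_pairs (initial_ideal w (toric_ideal A)).
    \<forall>j. j \<notin> \<sigma> \<longrightarrow> v $ j = of_nat (lookup a j)}"

definition Delta :: "int^'n^'d \<Rightarrow> real^'n \<Rightarrow> complex^'n::finite \<Rightarrow> 'n set set"
  where "Delta A w v = {\<tau>. \<exists>(a, \<sigma>) \<in> std_pairs_at A w v. \<tau> \<subseteq> \<sigma>}"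

definition link :: "int^'n^'d \<Rightarrow> real^'n \<Rightarrow> complex^'n::finite \<Rightarrow> 'n set set"
  where "link A w v =
    {\<tau> \<in> Delta A w v. \<tau> \<inter> nsupp v = {} \<and> \<tau> \<union> nsupp v \<in> Delta A w v}"

section \<open>Stanley--Reisner rings and dimensions\<close>

definition sr_ideal :: "'n::finite set \<Rightarrow> 'n set set \<Rightarrow> 'n mpol set"
  where "sr_ideal V \<Delta> = Idl\<^bsub>poly_ring V\<^esub> {(\<Prod>i\<in>\<tau>. pvar i) | \<tau>. \<tau> \<subseteq> V \<and> \<tau> \<notin> \<Delta>}"

definition sr_ring :: "'n::finite set \<Rightarrow> 'n set set \<Rightarrow> 'n mpol set ring"
  where "sr_ring V \<Delta> = poly_ring V Quot sr_ideal V \<Delta>"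

definition sr_class :: "'n::finite set \<Rightarrow> 'n set set \<Rightarrow> 'n mpol \<Rightarrow> 'n mpol set"
  where "sr_class V \<Delta> p = sr_ideal V \<Delta> +>\<^bsub>poly_ring V\<^esub> p"

text \<open>Both dimensions take the value \<open>-\<infinity>\<close> in the degenerate cases (zero ring, void complex);
  the complex with the empty face only has dimension \<open>-1\<close>.\<close>

definition krull_dim :: "('a, 'b) ring_scheme \<Rightarrow> ereal"
  where "krull_dim R = Sup {ereal (real m) | m.
    \<exists>P. (\<forall>i\<le>m. primeideal (P i) R) \<and> (\<forall>i<m. P i \<subset> P (Suc i))}"

definition complex_dim :: "'n::finite set set \<Rightarrow> ereal"
  where "complex_dim \<Delta> = (SUP \<tau>\<in>\<Delta>. ereal (real (card \<tau>) - 1))"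

section \<open>The ideal \<open>Q\<^sub>v\<close>\<close>

definition lin_ideal :: "int^'n^'d \<Rightarrow> 'n::finite mpol set"
  where "lin_ideal A = Idl\<^bsub>poly_ring UNIV\<^esub>
    (range (\<lambda>i. \<Sum>j\<in>UNIV. pconst (of_int (A $ i $ j)) * pvar j))"

text \<open>\<open>nsupp_shift v u\<close> is \<open>I\<^sub>u\<close>, and \<open>G_set v g\<^sub>+ g\<^sub>-\<close> is \<open>I\<^sub>-\<^sub>g - I\<^sub>0\<close> for \<open>g = g\<^sub>+ - g\<^sub>-\<close>.\<close>

definition nsupp_shift :: "complex^'n \<Rightarrow> int^'n \<Rightarrow> 'n::finite set"
  where "nsupp_shift v u = nsupp (v + (\<chi> j. of_int (u $ j)))"

definition G_set :: "complex^'n \<Rightarrow> ('n \<Rightarrow>\<^sub>0 nat) \<Rightarrow> ('n \<Rightarrow>\<^sub>0 nat) \<Rightarrow> 'n::finite set"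
  where "G_set v gp gm =
    nsupp_shift v (- (\<chi> j. int (lookup gp j) - int (lookup gm j))) - nsupp_shift v 0"

definition M_theta ::
    "complex^'n \<Rightarrow> nat \<Rightarrow> (nat \<Rightarrow> 'n \<Rightarrow>\<^sub>0 nat) \<Rightarrow> (nat \<Rightarrow> 'n \<Rightarrow>\<^sub>0 nat) \<Rightarrow> 'n::finite mpol set"
  where "M_theta v m gp gm = Idl\<^bsub>poly_ring UNIV\<^esub>
    ((\<lambda>i. \<Prod>j\<in>G_set v (gp i) (gm i). pvar j) ` {1..m})"

definition Q_ideal ::
    "int^'n^'d \<Rightarrow> complex^'n \<Rightarrow> nat \<Rightarrow> (nat \<Rightarrow> 'n \<Rightarrow>\<^sub>0 nat) \<Rightarrow> (nat \<Rightarrow> 'n \<Rightarrow>\<^sub>0 nat)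
      \<Rightarrow> 'n::finite mpol set"
  where "Q_ideal A v m gp gm = lin_ideal A <+>\<^bsub>poly_ring UNIV\<^esub> M_theta v m gp gm"

end

theory Submission
  imports Defs
begin

text \<open>
  The elements of a reduced Groebner basis of a toric ideal are binomials with disjoint supports.
  Hence a set \<open>\<tau>\<close> of variables outside \<open>I\<^sub>0 = nsupp v\<close> contains some \<open>G\<^sup>(\<^sup>i\<^sup>)\<close> iff, with the
  coordinates \<open>v\<^sub>j \<in> \<nat>\<close>, \<open>j \<notin> \<tau>\<close>, as fixed exponents, multiplication by variables in \<open>\<tau>\<close> and in the
  non-natural coordinates leads into the initial ideal, i.e. iff \<open>\<tau> \<union> I\<^sub>0\<close> is contained in no \<open>\<sigma>\<close> of a
  standard pair at \<open>v\<close>. So the monomials generating \<open>M\<^sub>\<theta>(v)\<close> also generate the Stanley--Reisner ideal of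
  the link, and substituting \<open>\<theta>\<^sub>i \<mapsto> L\<^sub>i\<close> for \<open>i \<in> I\<^sub>0\<close> gives the isomorphism.

  For the dimension, elements \<open>f\<^sub>i \<in> P\<^sub>i\<^sub>+\<^sub>1 - P\<^sub>i\<close> taken from a chain of primes of length \<open>m\<close> are algebraically
  independent modulo \<open>P\<^sub>0\<close>, and \<open>P\<^sub>0\<close> contains all variables outside some face \<open>\<tau>\<close>; counting monomials
  of bounded degree yields \<open>m \<le> |\<tau>|\<close>. The same count shows that no standard pair has more than \<open>d\<close>
  free variables.
\<close>

section \<open>Homomorphisms from polynomial rings\<close>

lemma lookup_pmon: "lookup (pmon u) u' = (if u = u' then 1 else 0)"
  by (simp add: pmon_def lookup_single when_def)

lemma keys_pmon [simp]: "keys (pmon u) = {u}"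
  by (simp add: pmon_def)

lemma pmon_0 [simp]: "pmon 0 = 1"
  by (simp add: pmon_def)

lemma pmon_add: "pmon (a + b) = pmon a * pmon b"
  by (simp add: pmon_def mult_single)

lemma pconst_0 [simp]: "pconst 0 = 0" and pconst_1 [simp]: "pconst 1 = 1"
  by (simp_all add: pconst_def)

lemma pconst_add: "pconst (a + b) = pconst a + pconst b"
  and pconst_mult: "pconst (a * b) = pconst a * pconst b"
  and pconst_uminus: "pconst (- a) = - pconst a"
  by (simp_all add: pconst_def single_add mult_single single_uminus)

lemma keys_pconst: "keys (pconst c) \<subseteq> {0}"
  by (simp add: pconst_def)

lemma single_eq_pconst_pmon: "Poly_Mapping.single u c = pconst c * pmon u"
  by (simp add: pconst_def pmon_def mult_single)

lemma keys_pvar [simp]: "keys (pvar j) = {Poly_Mapping.single j 1}"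
  by (simp add: pvar_def)

lemma mpol_eq_sum: "(\<Sum>u\<in>keys p. Poly_Mapping.single u (lookup p u)) = p"
  by (rule poly_mapping_eqI) (simp add: lookup_sum lookup_single when_def in_keys_iff)

lemma keys_multE:
  assumes "u \<in> keys (p * q)"
  obtains a b where "u = a + b" "a \<in> keys p" "b \<in> keys q"
  using assms Poly_Mapping.keys_mult[of p q] by blast

lemma pmon_eq_prod: "pmon u = (\<Prod>j\<in>UNIV. pvar j ^ lookup u j)" for u :: "'n::finite \<Rightarrow>\<^sub>0 nat"
proof -
  have pow: "pvar j ^ k = pmon (Poly_Mapping.single j k)" for j :: 'n and k
    by (induction k) (simp_all add: pvar_def flip: pmon_add single_add)
  have pr: "(\<Prod>j\<in>S. pmon (f j)) = pmon (\<Sum>j\<in>S. f j)" for f :: "'n \<Rightarrow> 'n \<Rightarrow>\<^sub>0 nat" and S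
    by (induction S rule: infinite_finite_induct) (simp_all add: pmon_add)
  have "(\<Sum>j\<in>UNIV. Poly_Mapping.single j (lookup u j)) = u"
    by (rule poly_mapping_eqI) (simp add: lookup_sum lookup_single when_def)
  then show ?thesis by (simp add: pow pr)
qed

lemma ring_poly_ring: "ring (poly_ring V)"
  using cring_poly_ring cring.axioms(1) by blast

section \<open>Ring homomorphisms determined by their values on coefficients and monomials\<close>

definition mpol_ext :: "(complex \<Rightarrow> 'r) \<Rightarrow> (('n \<Rightarrow>\<^sub>0 nat) \<Rightarrow> 'r) \<Rightarrow> 'n mpol \<Rightarrow> 'r::comm_ring_1"
  where "mpol_ext \<kappa> \<mu> p = (\<Sum>u\<in>keys p. \<kappa> (lookup p u) * \<mu> u)"

text \<open>The target is an arbitrary commutative ring, so that one set of rules serves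
  substitutions into polynomial rings as well as maps into monoid algebras such as the group algebra
  of the lattice containing the columns of \<open>A\<close>.\<close>

locale mpol_hom =
  fixes \<kappa> :: "complex \<Rightarrow> 'r::comm_ring_1" and \<mu> :: "('n \<Rightarrow>\<^sub>0 nat) \<Rightarrow> 'r"
  assumes const_add: "\<kappa> (a + b) = \<kappa> a + \<kappa> b"
    and const_mult: "\<kappa> (a * b) = \<kappa> a * \<kappa> b"
    and const_one: "\<kappa> 1 = 1"
    and mon_zero: "\<mu> 0 = 1"
    and mon_add: "\<mu> (u + u') = \<mu> u * \<mu> u'"
begin

lemma const_zero: "\<kappa> 0 = 0"
  using const_add[of 0 0] by simp

text \<open>Allows polynomials with different supports to be compared over a common index
  set.\<close>

lemma ext_superset:
  assumes "finite S" "keys p \<subseteq> S"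
  shows "mpol_ext \<kappa> \<mu> p = (\<Sum>u\<in>S. \<kappa> (lookup p u) * \<mu> u)"
  unfolding mpol_ext_def using assms
  by (intro sum.mono_neutral_left) (auto simp: in_keys_iff const_zero)

lemma ext_add: "mpol_ext \<kappa> \<mu> (p + q) = mpol_ext \<kappa> \<mu> p + mpol_ext \<kappa> \<mu> q"
proof -
  let ?S = "keys p \<union> keys q"
  have "mpol_ext \<kappa> \<mu> (p + q) = (\<Sum>u\<in>?S. \<kappa> (lookup (p + q) u) * \<mu> u)"
    by (rule ext_superset) (auto simp: keys_add)
  also have "\<dots> = (\<Sum>u\<in>?S. \<kappa> (lookup p u) * \<mu> u) + (\<Sum>u\<in>?S. \<kappa> (lookup q u) * \<mu> u)"
    by (simp add: lookup_add const_add algebra_simps sum.distrib)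
  also have "\<dots> = mpol_ext \<kappa> \<mu> p + mpol_ext \<kappa> \<mu> q"
    by (simp add: ext_superset[of ?S])
  finally show ?thesis .
qed

lemma ext_zero: "mpol_ext \<kappa> \<mu> 0 = 0"
  by (simp add: mpol_ext_def)

lemma ext_sum: "mpol_ext \<kappa> \<mu> (\<Sum>i\<in>S. f i) = (\<Sum>i\<in>S. mpol_ext \<kappa> \<mu> (f i))"
  by (induction S rule: infinite_finite_induct) (simp_all add: ext_zero ext_add)

lemma ext_single: "mpol_ext \<kappa> \<mu> (Poly_Mapping.single u c) = \<kappa> c * \<mu> u"
  using ext_superset[of "{u}" "Poly_Mapping.single u c"] by simp

lemma ext_const: "mpol_ext \<kappa> \<mu> (pconst c) = \<kappa> c"
  by (simp add: pconst_def ext_single mon_zero)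

lemma ext_mon: "mpol_ext \<kappa> \<mu> (pmon u) = \<mu> u"
  by (simp add: pmon_def ext_single const_one)

lemma ext_one: "mpol_ext \<kappa> \<mu> 1 = 1"
  using ext_const[of 1] by (simp add: const_one)

lemma ext_mult: "mpol_ext \<kappa> \<mu> (p * q) = mpol_ext \<kappa> \<mu> p * mpol_ext \<kappa> \<mu> q"
proof -
  have "p * q = (\<Sum>u\<in>keys p. \<Sum>u'\<in>keys q. Poly_Mapping.single (u + u') (lookup p u * lookup q u'))"
    by (subst (1 2) mpol_eq_sum[symmetric]) (simp add: sum_product mult_single)
  also have "mpol_ext \<kappa> \<mu> \<dots> = (\<Sum>u\<in>keys p. \<Sum>u'\<in>keys q.
      (\<kappa> (lookup p u) * \<mu> u) * (\<kappa> (lookup q u') * \<mu> u'))"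
    by (simp add: ext_sum ext_single const_mult mon_add algebra_simps)
  also have "\<dots> = mpol_ext \<kappa> \<mu> p * mpol_ext \<kappa> \<mu> q"
    by (simp add: mpol_ext_def sum_product)
  finally show ?thesis .
qed

lemma ext_uminus: "mpol_ext \<kappa> \<mu> (- p) = - mpol_ext \<kappa> \<mu> p"
  using ext_add[of p "- p"] by (simp add: ext_zero eq_neg_iff_add_eq_0 add.commute)

lemma ext_diff: "mpol_ext \<kappa> \<mu> (p - q) = mpol_ext \<kappa> \<mu> p - mpol_ext \<kappa> \<mu> q"
  using ext_add[of p "- q"] by (simp add: ext_uminus)

lemma ext_prod: "mpol_ext \<kappa> \<mu> (\<Prod>i\<in>S. f i) = (\<Prod>i\<in>S. mpol_ext \<kappa> \<mu> (f i))"
  by (induction S rule: infinite_finite_induct) (simp_all add: ext_one ext_mult)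

end

section \<open>Maps of monoid algebras induced by maps of exponents; absence of zero
  divisors\<close>

definition push_exponents :: "(('n \<Rightarrow>\<^sub>0 nat) \<Rightarrow> 'm::comm_monoid_add) \<Rightarrow> 'n mpol \<Rightarrow> 'm \<Rightarrow>\<^sub>0 complex"
  where "push_exponents f = mpol_ext (Poly_Mapping.single 0) (\<lambda>u. Poly_Mapping.single (f u) 1)"

lemma mpol_hom_push:
  assumes "f 0 = 0" "\<And>a b. f (a + b) = f a + f b"
  shows "mpol_hom (Poly_Mapping.single 0 :: complex \<Rightarrow> 'm::comm_monoid_add \<Rightarrow>\<^sub>0 complex)
           (\<lambda>u. Poly_Mapping.single (f u) 1)"
  by unfold_locales (simp_all add: assms single_add mult_single)

lemma lookup_push_exponents:
  "lookup (push_exponents f p) b = (\<Sum>u\<in>keys p. if f u = b then lookup p u else 0)"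
  by (simp add: push_exponents_def mpol_ext_def lookup_sum mult_single lookup_single when_def)

text \<open>Numbering the variables embeds the exponents into
  \<open>nat \<Rightarrow>\<^sub>0 nat\<close>, which carries a linear order compatible with
  addition. The polynomials over that monoid therefore have no zero divisors, and the induced ring
  homomorphism is injective because the map of exponents is.\<close>

lemma mpol_mult_eq_0:
  fixes p q :: "'n::finite mpol"
  assumes "p * q = 0"
  shows "p = 0 \<or> q = 0"
proof -
  obtain idx :: "'n \<Rightarrow> nat" where idx: "inj idx"
    using finite_imp_inj_to_nat_seg[of "UNIV :: 'n set"] by auto
  define f :: "('n \<Rightarrow>\<^sub>0 nat) \<Rightarrow> (nat \<Rightarrow>\<^sub>0 nat)"
    where "f u = (\<Sum>j\<in>UNIV. Poly_Mapping.single (idx j) (lookup u j))" for u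
  have f0: "f 0 = 0" by (simp add: f_def)
  have fadd: "f (a + b) = f a + f b" for a b
    by (simp add: f_def lookup_add single_add sum.distrib)
  have look: "lookup (f u) (idx j) = lookup u j" for u j
    by (simp add: f_def lookup_sum lookup_single when_def inj_eq[OF idx])
  have inj: "f u = f u' \<longleftrightarrow> u = u'" for u u'
    by (metis look poly_mapping_eqI)
  interpret mpol_hom "Poly_Mapping.single 0 :: complex \<Rightarrow> (nat \<Rightarrow>\<^sub>0 nat) \<Rightarrow>\<^sub>0 complex"
      "\<lambda>u. Poly_Mapping.single (f u) 1"
    by (rule mpol_hom_push) (simp_all add: f0 fadd)
  have "push_exponents f p * push_exponents f q = 0"
    using ext_mult[of p q] assms by (simp add: push_exponents_def ext_zero)
  then have "push_exponents f p = 0 \<or> push_exponents f q = 0"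
    by simp
  moreover have "r = 0" if "push_exponents f r = 0" for r
  proof (rule poly_mapping_eqI)
    fix u
    have "lookup (push_exponents f r) (f u) = lookup r u"
      by (simp add: lookup_push_exponents inj in_keys_iff)
    then show "lookup r u = lookup 0 u" using that by simp
  qed
  ultimately show ?thesis by blast
qed

section \<open>Substitution of polynomials for variables\<close>

definition subst :: "('n::finite \<Rightarrow> 'm mpol) \<Rightarrow> 'n mpol \<Rightarrow> 'm mpol"
  where "subst h = mpol_ext pconst (\<lambda>u. \<Prod>j\<in>UNIV. h j ^ lookup u j)"

lemma mpol_hom_subst: "mpol_hom pconst (\<lambda>u. \<Prod>j\<in>UNIV. h j ^ lookup u j)"
  by unfold_locales
    (simp_all add: pconst_add pconst_mult lookup_add power_add prod.distrib)

lemma subst_add: "subst h (p + q) = subst h p + subst h q"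
  and subst_diff: "subst h (p - q) = subst h p - subst h q"
  and subst_mult: "subst h (p * q) = subst h p * subst h q"
  and subst_zero: "subst h 0 = 0"
  and subst_one: "subst h 1 = 1"
  and subst_const: "subst h (pconst c) = pconst c"
  and subst_prod: "subst h (prod f S) = (\<Prod>i\<in>S. subst h (f i))"
proof -
  interpret mpol_hom pconst "\<lambda>u. \<Prod>j\<in>UNIV. h j ^ lookup u j"
    by (rule mpol_hom_subst)
  show "subst h (p + q) = subst h p + subst h q" "subst h (p - q) = subst h p - subst h q"
    "subst h (p * q) = subst h p * subst h q" "subst h 0 = 0" "subst h 1 = 1"
    "subst h (pconst c) = pconst c" "subst h (prod f S) = (\<Prod>i\<in>S. subst h (f i))"
    unfolding subst_def
    by (fact ext_add ext_diff ext_mult ext_zero ext_one ext_const ext_prod)+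
qed

lemma subst_pvar: "subst h (pvar j) = h j"
proof -
  have "(\<Prod>i\<in>UNIV. h i ^ lookup (Poly_Mapping.single j 1) i) = (\<Prod>i\<in>UNIV. if i = j then h j else 1)"
    by (intro prod.cong) (auto simp: lookup_single when_def)
  then show ?thesis
    using mpol_hom.ext_mon[OF mpol_hom_subst, of h "Poly_Mapping.single j 1", folded subst_def]
    by (simp add: pvar_def)
qed

lemma subst_cong_vars:
  assumes "\<forall>u\<in>keys p. keys u \<subseteq> V" "\<And>j. j \<in> V \<Longrightarrow> h j = pvar j"
  shows "subst h p = p"
proof -
  have "(\<Prod>j\<in>UNIV. h j ^ lookup u j) = pmon u" if "u \<in> keys p" for u
    unfolding pmon_eq_prod using that assms
    by (intro prod.cong refl) (metis in_keys_iff power_0 subsetD)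
  then have "subst h p = (\<Sum>u\<in>keys p. pconst (lookup p u) * pmon u)"
    unfolding subst_def mpol_ext_def by (intro sum.cong) auto
  also have "\<dots> = p"
    by (simp add: mpol_eq_sum flip: single_eq_pconst_pmon)
  finally show ?thesis .
qed

section \<open>Monomial ideals, Groebner bases and the link\<close>

lemma ideal_poly_ringI:
  assumes "\<And>p. p \<in> I \<Longrightarrow> \<forall>u\<in>keys p. keys u \<subseteq> V" "0 \<in> I"
    and "\<And>p q. p \<in> I \<Longrightarrow> q \<in> I \<Longrightarrow> p + q \<in> I"
    and mult: "\<And>p q. \<forall>u\<in>keys p. keys u \<subseteq> V \<Longrightarrow> q \<in> I \<Longrightarrow> p * q \<in> I"
  shows "ideal I (poly_ring V)"
proof (rule idealI)
  interpret cring "poly_ring V" by (rule cring_poly_ring)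
  show "subgroup I (add_monoid (poly_ring V))"
  proof (rule add.subgroupI)
    fix p assume p: "p \<in> I"
    then have "- p \<in> I" using mult[of "- 1" p] by simp
    moreover have "\<ominus>\<^bsub>poly_ring V\<^esub> p = - p"
      using assms(1)[OF p] by (intro minus_equality) auto
    ultimately show "\<ominus>\<^bsub>poly_ring V\<^esub> p \<in> I" by simp
  qed (use assms in auto)
next
  fix a x assume "a \<in> I" "x \<in> carrier (poly_ring V)"
  then show "x \<otimes>\<^bsub>poly_ring V\<^esub> a \<in> I" "a \<otimes>\<^bsub>poly_ring V\<^esub> x \<in> I"
    using mult[of x a] by (simp_all add: mult.commute)
qed (rule ring_poly_ring)

context
  fixes I :: "'n mpol set" and V :: "'n set"
  assumes I: "ideal I (poly_ring V)"
begin

lemma ideal_zero: "0 \<in> I"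
  using additive_subgroup.zero_closed[OF ideal.axioms(1)[OF I]] by simp

lemma ideal_add: "p \<in> I \<Longrightarrow> q \<in> I \<Longrightarrow> p + q \<in> I"
  using additive_subgroup.a_closed[OF ideal.axioms(1)[OF I], of p q] by simp

lemma ideal_mult: "\<forall>u\<in>keys p. keys u \<subseteq> V \<Longrightarrow> q \<in> I \<Longrightarrow> p * q \<in> I"
  using ideal.I_l_closed[OF I, of q p] by simp

lemma ideal_uminus: "p \<in> I \<Longrightarrow> - p \<in> I"
  using ideal_mult[of "- 1" p] by simp

lemma ideal_diff: "p \<in> I \<Longrightarrow> q \<in> I \<Longrightarrow> p - q \<in> I"
  using ideal_add[of p "- q"] ideal_uminus by simp

lemma ideal_sum: "(\<And>i. i \<in> S \<Longrightarrow> f i \<in> I) \<Longrightarrow> sum f S \<in> I"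
  by (induction S rule: infinite_finite_induct) (auto simp: ideal_zero ideal_add)

end

lemma Idl_poly_ring:
  assumes "\<And>s u. s \<in> S \<Longrightarrow> u \<in> keys s \<Longrightarrow> keys u \<subseteq> V"
  shows ideal_Idl: "ideal (Idl\<^bsub>poly_ring V\<^esub> S) (poly_ring V)"
    and Idl_self: "s \<in> S \<Longrightarrow> s \<in> Idl\<^bsub>poly_ring V\<^esub> S"
proof -
  have S: "S \<subseteq> carrier (poly_ring V)" using assms by auto
  show "ideal (Idl\<^bsub>poly_ring V\<^esub> S) (poly_ring V)"
    by (rule ring.genideal_ideal[OF ring_poly_ring S])
  show "s \<in> S \<Longrightarrow> s \<in> Idl\<^bsub>poly_ring V\<^esub> S"
    using ring.genideal_self[OF ring_poly_ring S] by blast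
qed

lemma Idl_subsetI: "ideal I (poly_ring V) \<Longrightarrow> S \<subseteq> I \<Longrightarrow> Idl\<^bsub>poly_ring V\<^esub> S \<subseteq> I"
  by (rule ring.genideal_minimal[OF ring_poly_ring])

text \<open>The polynomials all of whose monomials are divisible by a generator form an ideal
  containing the generators. Conversely, each term of such a polynomial is a multiple of a
  generator.\<close>

lemma in_Idl_pmon_iff:
  "p \<in> Idl\<^bsub>poly_ring UNIV\<^esub> (pmon ` E) \<longleftrightarrow>
     (\<forall>u\<in>keys p. \<exists>e\<in>E. \<forall>j. lookup e j \<le> lookup u j)" (is "_ \<longleftrightarrow> ?R p")
proof
  have "ideal {p. ?R p} (poly_ring UNIV)"
  proof (rule ideal_poly_ringI)
    fix p q assume "p \<in> {p. ?R p}" "q \<in> {p. ?R p}"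
    then show "p + q \<in> {p. ?R p}" using Poly_Mapping.keys_add[of p q] by blast
  next
    fix p q assume q: "q \<in> {p. ?R p}"
    have "\<exists>e\<in>E. \<forall>j. lookup e j \<le> lookup u j" if u: "u \<in> keys (p * q)" for u
    proof -
      obtain a b where ab: "u = a + b" "b \<in> keys q"
        using u by (rule keys_multE)
      then obtain e where "e \<in> E" "\<forall>j. lookup e j \<le> lookup b j" using q by blast
      then show ?thesis unfolding ab(1) lookup_add by (blast intro: trans_le_add2)
    qed
    then show "p * q \<in> {p. ?R p}" by blast
  qed auto
  then have "Idl\<^bsub>poly_ring UNIV\<^esub> (pmon ` E) \<subseteq> {p. ?R p}"
    by (rule Idl_subsetI) auto
  then show "p \<in> Idl\<^bsub>poly_ring UNIV\<^esub> (pmon ` E) \<Longrightarrow> ?R p" by blast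
next
  assume R: "?R p"
  let ?I = "Idl\<^bsub>poly_ring UNIV\<^esub> (pmon ` E)"
  have I: "ideal ?I (poly_ring UNIV)" by (rule ideal_Idl) simp
  have "Poly_Mapping.single u (lookup p u) \<in> ?I" if u: "u \<in> keys p" for u
  proof -
    obtain e where e: "e \<in> E" "\<forall>j. lookup e j \<le> lookup u j" using R u by blast
    \<comment> \<open>The truncated subtraction of exponents is exact here, since \<open>e\<close>
      is coordinatewise below \<open>u\<close>.\<close>
    then have "u = (u - e) + e"
      by (intro poly_mapping_eqI) (simp add: lookup_add lookup_minus)
    then have "pmon u = pmon (u - e) * pmon e"
      by (metis pmon_add)
    moreover have "pmon e \<in> ?I" using e by (intro Idl_self) auto
    ultimately show ?thesis
      unfolding single_eq_pconst_pmon by (auto intro!: ideal_mult[OF I])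
  qed
  then have "(\<Sum>u\<in>keys p. Poly_Mapping.single u (lookup p u)) \<in> ?I"
    by (rule ideal_sum[OF I])
  then show "p \<in> ?I" by (simp add: mpol_eq_sum)
qed

lemma pmon_in_Idl_iff:
  "pmon u \<in> Idl\<^bsub>poly_ring UNIV\<^esub> (pmon ` E) \<longleftrightarrow> (\<exists>e\<in>E. \<forall>j. lookup e j \<le> lookup u j)"
  by (simp add: in_Idl_pmon_iff)

section \<open>Initial forms and the binomials of a toric ideal\<close>

lemma lookup_initial_form:
  "lookup (initial_form w p) u =
     (if \<forall>u'\<in>keys p. weight w u' \<le> weight w u then lookup p u else 0)"
  by (auto simp: initial_form_def lookup_sum lookup_single when_def in_keys_iff)

lemma keys_initial_form:
  "u \<in> keys (initial_form w p) \<longleftrightarrow> u \<in> keys p \<and> (\<forall>u'\<in>keys p. weight w u' \<le> weight w u)"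
  by (simp add: in_keys_iff lookup_initial_form)

lemma keys_binomial: "u \<noteq> u' \<Longrightarrow> keys (pmon u - pmon u') = {u, u'}"
  by (auto simp: in_keys_iff lookup_minus lookup_pmon split: if_splits)

lemma initial_form_binomial:
  assumes "weight w u' < weight w u"
  shows "initial_form w (pmon u - pmon u') = pmon u"
proof -
  have "u \<noteq> u'" using assms by auto
  then show ?thesis
    using assms by (intro poly_mapping_eqI)
      (auto simp: lookup_initial_form keys_binomial lookup_minus lookup_pmon)
qed

text \<open>The coefficient 1 of \<open>pmon s\<close> rules out \<open>u'\<close>, which has
  coefficient -1 in the binomial. As \<open>u'\<close> does not survive in the initial form, its
  weight must be strictly smaller.\<close>

lemma initial_form_binomial_eq_pmon:
  assumes "initial_form w (pmon u - pmon u') = pmon s"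
  shows "s = u" "weight w u' < weight w u"
proof -
  have ne: "u \<noteq> u'"
    using assms keys_initial_form[of s w "pmon u - pmon u'"] by auto
  have s: "s \<in> {u, u'}"
    using assms keys_initial_form[of s w "pmon u - pmon u'"] ne by (auto simp: keys_binomial)
  have "lookup (pmon u - pmon u') s = 1"
    using assms lookup_initial_form[of w "pmon u - pmon u'" s]
    by (auto simp: lookup_pmon split: if_splits)
  then show "s = u" using s ne by (auto simp: lookup_minus lookup_pmon)
  then show "weight w u' < weight w u"
    using assms keys_initial_form[of u' w "pmon u - pmon u'"]
      keys_initial_form[of u w "pmon u - pmon u'"] ne
    by (auto simp: keys_binomial)
qed

lemma mat_exp_add: "mat_exp A (a + b) = mat_exp A a + mat_exp A b"
  by (simp add: mat_exp_def vec_eq_iff lookup_add algebra_simps sum.distrib)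

lemma mat_exp_zero: "mat_exp A 0 = 0"
  by (simp add: mat_exp_def vec_eq_iff)

lemma weight_add: "weight w (a + b) = weight w a + weight w b"
  by (simp add: weight_def lookup_add algebra_simps sum.distrib)

text \<open>Sending a monomial with exponent \<open>u\<close> to the basis element
  \<open>mat_exp A u\<close> of the group algebra of the integer lattice is a ring homomorphism that
  kills the generators of the toric ideal, hence the whole ideal. A binomial is killed only if its
  two exponents have the same image.\<close>

lemma binomial_in_toric_ideal_iff:
  "pmon u - pmon u' \<in> toric_ideal A \<longleftrightarrow> mat_exp A u = mat_exp A u'"
proof
  assume "mat_exp A u = mat_exp A u'"
  then show "pmon u - pmon u' \<in> toric_ideal A"
    unfolding toric_ideal_def by (intro Idl_self) auto
next
  interpret mpol_hom "Poly_Mapping.single 0 :: complex \<Rightarrow> (int^'b) \<Rightarrow>\<^sub>0 complex"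
      "\<lambda>u. Poly_Mapping.single (mat_exp A u) 1"
    by (rule mpol_hom_push) (simp_all add: mat_exp_zero mat_exp_add)
  let ?f = "mpol_ext (Poly_Mapping.single 0) (\<lambda>u. Poly_Mapping.single (mat_exp A u) 1)
              :: 'a mpol \<Rightarrow> (int^'b) \<Rightarrow>\<^sub>0 complex"
  have "ideal {p. ?f p = 0} (poly_ring UNIV)"
    by (rule ideal_poly_ringI) (auto simp: ext_zero ext_add ext_mult)
  then have "toric_ideal A \<subseteq> {p. ?f p = 0}"
    unfolding toric_ideal_def
    by (rule Idl_subsetI) (auto simp: ext_diff ext_mon)
  moreover assume "pmon u - pmon u' \<in> toric_ideal A"
  ultimately have "?f (pmon u - pmon u') = 0" by blast
  then have "Poly_Mapping.single (mat_exp A u) (1::complex) = Poly_Mapping.single (mat_exp A u') 1"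
    by (simp add: ext_diff ext_mon)
  then have "lookup (Poly_Mapping.single (mat_exp A u) (1::complex)) (mat_exp A u') = 1"
    by simp
  then show "mat_exp A u = mat_exp A u'"
    by (simp add: lookup_single when_def split: if_splits)
qed

lemma initial_form_in_initial_ideal: "p \<in> I \<Longrightarrow> initial_form w p \<in> initial_ideal w I"
  unfolding initial_ideal_def by (intro Idl_self) auto

lemma ideal_initial_ideal: "ideal (initial_ideal w I) (poly_ring UNIV)"
  unfolding initial_ideal_def by (intro ideal_Idl) auto

text \<open>The initial form of the binomial keeps at least one of the two terms, and a monomial
  ideal contains every monomial occurring in one of its members.\<close>

lemma generic_weight_binomial:
  assumes "generic_weight A w" "mat_exp A u = mat_exp A u'" "u \<noteq> u'"
  shows "pmon u \<in> initial_ideal w (toric_ideal A) \<or> pmon u' \<in> initial_ideal w (toric_ideal A)"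
proof -
  let ?M = "initial_ideal w (toric_ideal A)" and ?p = "pmon u - pmon u'"
  obtain E where E: "?M = Idl\<^bsub>poly_ring UNIV\<^esub> (pmon ` E)"
    using assms(1) by (auto simp: generic_weight_def monomial_ideal_def)
  have "initial_form w ?p \<in> ?M"
    using assms by (intro initial_form_in_initial_ideal) (simp add: binomial_in_toric_ideal_iff)
  then have "\<forall>s\<in>keys (initial_form w ?p). \<exists>e\<in>E. \<forall>j. lookup e j \<le> lookup s j"
    unfolding E in_Idl_pmon_iff .
  then have "\<forall>s\<in>keys (initial_form w ?p). pmon s \<in> ?M"
    unfolding E pmon_in_Idl_iff .
  moreover have "u \<in> keys (initial_form w ?p) \<or> u' \<in> keys (initial_form w ?p)"
    using assms(3) by (auto simp: keys_initial_form keys_binomial)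
  ultimately show ?thesis by blast
qed

section \<open>Reduced Groebner bases consisting of binomials\<close>

context
  fixes A :: "int^'n::finite^'d" and w :: "real^'n" and m :: nat and gp gm :: "nat \<Rightarrow> 'n \<Rightarrow>\<^sub>0 nat"
  assumes groebner: "reduced_groebner_basis w (toric_ideal A)
          ((\<lambda>i. pmon (gp i) - pmon (gm i)) ` {1..m})"
begin

text \<open>A reduced basis has monomials with coefficient 1 as initial forms; for a binomial the
  sign then singles out \<open>gp i\<close> as the leading exponent.\<close>

lemma groebner_initial_form:
  assumes "i \<in> {1..m}"
  shows "initial_form w (pmon (gp i) - pmon (gm i)) = pmon (gp i)" "weight w (gm i) < weight w (gp i)"
proof -
  obtain s where "initial_form w (pmon (gp i) - pmon (gm i)) = pmon s"
    using groebner assms unfolding reduced_groebner_basis_def by blast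
  then show "initial_form w (pmon (gp i) - pmon (gm i)) = pmon (gp i)"
    "weight w (gm i) < weight w (gp i)"
    using initial_form_binomial_eq_pmon by metis+
qed

lemma groebner_initial_ideal:
  "initial_ideal w (toric_ideal A) = Idl\<^bsub>poly_ring UNIV\<^esub> (pmon ` gp ` {1..m})"
proof -
  have "initial_form w ` (\<lambda>i. pmon (gp i) - pmon (gm i)) ` {1..m} = pmon ` gp ` {1..m}"
    unfolding image_image by (intro image_cong refl groebner_initial_form(1))
  then show ?thesis using groebner unfolding reduced_groebner_basis_def by metis
qed

lemma pmon_in_groebner_initial_ideal_iff:
  "pmon u \<in> initial_ideal w (toric_ideal A) \<longleftrightarrow>
     (\<exists>i\<in>{1..m}. \<forall>j. lookup (gp i) j \<le> lookup u j)"
  unfolding groebner_initial_ideal pmon_in_Idl_iff by simp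

text \<open>A variable dividing both terms can be cancelled inside the toric ideal, which would make the
  leading term redundant.\<close>

lemma groebner_disjoint_supports:
  assumes i: "i \<in> {1..m}"
  shows "lookup (gp i) j = 0 \<or> lookup (gm i) j = 0"
proof (rule ccontr)
  assume ne: "\<not> ?thesis"
  define e where "e = Poly_Mapping.single j (1::nat)"
  define p q where "p = gp i - e" and "q = gm i - e"
  have p: "gp i = p + e" and q: "gm i = q + e"
    using ne by (auto intro!: poly_mapping_eqI
        simp: p_def q_def e_def lookup_add lookup_minus lookup_single when_def)
  let ?g = "\<lambda>i. pmon (gp i) - pmon (gm i)"
  have "?g i \<in> toric_ideal A"
    using groebner i unfolding reduced_groebner_basis_def by blast
  then have "mat_exp A p = mat_exp A q"
    by (simp add: binomial_in_toric_ideal_iff p q mat_exp_add)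
  then have "initial_form w (pmon p - pmon q) \<in> initial_ideal w (toric_ideal A)"
    by (intro initial_form_in_initial_ideal) (simp add: binomial_in_toric_ideal_iff)
  moreover have "weight w q < weight w p"
    using groebner_initial_form(2)[OF i] by (simp add: p q weight_add)
  ultimately have "pmon p \<in> initial_ideal w (toric_ideal A)"
    by (simp add: initial_form_binomial)
  then obtain k where k: "k \<in> {1..m}" "\<forall>j. lookup (gp k) j \<le> lookup p j"
    unfolding pmon_in_groebner_initial_ideal_iff by blast
  have le: "\<forall>j. lookup (gp k) j \<le> lookup (gp i) j"
    using k(2) by (simp add: p lookup_add trans_le_add1)
  \<comment> \<open>In coordinate \<open>j\<close> the exponent \<open>p\<close> is smaller than
    \<open>gp i\<close> by one, so a divisor of \<open>pmon p\<close> cannot be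
    \<open>pmon (gp i)\<close>.\<close>
  have "gp k \<noteq> gp i"
  proof
    assume "gp k = gp i"
    then show False using k(2) by (auto simp: p lookup_add e_def dest: spec[of _ j])
  qed
  \<comment> \<open>A basis element determines its leading exponent, so different leading exponents
    belong to different elements. Thus the leading term of \<open>?g i\<close> is a multiple of that
    of another element, against reducedness.\<close>
  then have "?g k \<noteq> ?g i"
    using groebner_initial_form(1)[OF i] groebner_initial_form(1)[OF k(1)] keys_pmon
    by (metis singleton_inject)
  then have "?g k \<in> ?g ` {1..m} - {?g i}" using k(1) by blast
  then have "pmon (gp k) \<in> initial_form w ` (?g ` {1..m} - {?g i})"
    by (rule image_eqI[rotated]) (rule groebner_initial_form(1)[OF k(1), symmetric])
  then have "pmon (gp k) \<in> Idl\<^bsub>poly_ring UNIV\<^esub> (initial_form w ` (?g ` {1..m} - {?g i}))"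
    by (intro Idl_self) auto
  moreover have "pmon (gp i) = pmon (gp i - gp k) * pmon (gp k)"
    unfolding pmon_add[symmetric] using le
    by (intro arg_cong[of _ _ pmon] poly_mapping_eqI) (simp add: lookup_add lookup_minus)
  ultimately have "pmon (gp i) \<in> Idl\<^bsub>poly_ring UNIV\<^esub> (initial_form w ` (?g ` {1..m} - {?g i}))"
    by (simp only:) (rule ideal_mult[OF ideal_Idl], auto)
  moreover have "gp i \<in> keys (?g i)"
    using groebner_initial_form(2)[OF i] by (subst keys_binomial) auto
  moreover have "?g i \<in> ?g ` {1..m}" using i by blast
  ultimately show False
    using groebner unfolding reduced_groebner_basis_def by blast
qed

end

section \<open>Standard pairs at a vector and the complex of their free sets\<close>

definition nat_coords :: "complex^'n \<Rightarrow> 'n set"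
  where "nat_coords v = {j. v $ j \<in> \<nat>}"

text \<open>The first component of a standard pair at \<open>v\<close> with free set
  \<open>- S\<close>. The choice operator yields the intended exponents only if \<open>S\<close>
  lies in \<open>nat_coords v\<close>.\<close>

definition nat_part :: "complex^'n \<Rightarrow> 'n::finite set \<Rightarrow> 'n \<Rightarrow>\<^sub>0 nat"
  where "nat_part v S = (\<Sum>j\<in>S. Poly_Mapping.single j (SOME k. v $ j = of_nat k))"

lemma lookup_nat_part:
  assumes "S \<subseteq> nat_coords v"
  shows "j \<in> S \<Longrightarrow> v $ j = of_nat (lookup (nat_part v S) j)"
    and "j \<notin> S \<Longrightarrow> lookup (nat_part v S) j = 0"
proof -
  have *: "lookup (nat_part v S) j = (if j \<in> S then SOME k. v $ j = of_nat k else 0)"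
    by (simp add: nat_part_def lookup_sum lookup_single when_def)
  show "j \<in> S \<Longrightarrow> v $ j = of_nat (lookup (nat_part v S) j)"
    using assms by (auto simp: * nat_coords_def Nats_def intro: someI_ex)
  show "j \<notin> S \<Longrightarrow> lookup (nat_part v S) j = 0" by (simp add: *)
qed

text \<open>Fixing one more coordinate multiplies the monomial by another one, which keeps it in any
  ideal that contains it.\<close>

lemma nat_part_insert: "l \<notin> S \<Longrightarrow> \<exists>c. nat_part v (insert l S) = nat_part v S + c"
  by (auto simp: nat_part_def add.commute)

text \<open>The two assumptions say that \<rho>' is \<rho> enlarged by the coordinates where
  \<open>v\<close> is not a natural number; these are free in every standard pair at
  \<open>v\<close>. In the other coordinates a pair may only fix the exponents prescribed by
  \<open>v\<close>, so the free set determines the pair, and the question is whether \<rho>' extends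
  to an admissible free set.\<close>

lemma Delta_iff:
  fixes A :: "int^'n::finite^'d"
  assumes "\<rho> \<union> - nat_coords v \<subseteq> \<rho>'" "\<rho>' \<subseteq> \<rho> \<union> - nat_coords v"
  shows "\<rho> \<in> Delta A w v \<longleftrightarrow>
    (\<forall>b. keys b \<subseteq> \<rho>' \<longrightarrow> pmon (nat_part v (- \<rho>') + b) \<notin> initial_ideal w (toric_ideal A))"
    (is "_ \<longleftrightarrow> ?P \<rho>'")
proof
  let ?M = "initial_ideal w (toric_ideal A)"
  have up: "pmon (u + c) \<in> ?M" if "pmon u \<in> ?M" for u c
    using ideal_mult[OF ideal_initial_ideal, of "pmon c" "pmon u"] that
    by (simp add: pmon_add mult.commute)
  { assume "\<rho> \<in> Delta A w v"
    then obtain a \<sigma> where a: "(a, \<sigma>) \<in> standard_pairs ?M"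
        "\<forall>j. j \<notin> \<sigma> \<longrightarrow> v $ j = of_nat (lookup a j)" "\<rho> \<subseteq> \<sigma>"
      by (auto simp: Delta_def std_pairs_at_def)
    have sub: "\<rho>' \<subseteq> \<sigma>" using a(2,3) assms(2) by (auto simp: nat_coords_def)
    have nc: "- \<rho>' \<subseteq> nat_coords v" using assms(1) by blast
    show "?P \<rho>'"
    proof (intro allI impI notI)
      fix b assume b: "keys b \<subseteq> \<rho>'" "pmon (nat_part v (- \<rho>') + b) \<in> ?M"
      \<comment> \<open>The part of the exponent on \<sigma>. Outside \<sigma> the exponent agrees
        with \<open>a\<close>: there \<open>b\<close> vanishes and both remaining exponents are
        equal to the coordinate of \<open>v\<close>.\<close>
      define c where "c = (\<Sum>j\<in>\<sigma>. Poly_Mapping.single j (lookup (nat_part v (- \<rho>') + b) j))"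
      have c: "lookup c j = (if j \<in> \<sigma> then lookup (nat_part v (- \<rho>') + b) j else 0)" for j
        by (simp add: c_def lookup_sum lookup_single when_def)
      have "nat_part v (- \<rho>') + b = a + c"
      proof (rule poly_mapping_eqI)
        fix j
        show "lookup (nat_part v (- \<rho>') + b) j = lookup (a + c) j"
        proof (cases "j \<in> \<sigma>")
          case True
          then show ?thesis using a(1) by (simp add: standard_pairs_def lookup_add c)
        next
          case False
          then have "lookup b j = 0" using b(1) sub by (auto simp: in_keys_iff)
          moreover have "lookup (nat_part v (- \<rho>')) j = lookup a j"
            using False sub a(2) lookup_nat_part(1)[OF nc, of j]
            by (metis ComplI of_nat_eq_iff subsetD)
          ultimately show ?thesis using False by (simp add: lookup_add c)
        qed
      qed
      moreover have "keys c \<subseteq> \<sigma>" by (auto simp: in_keys_iff c split: if_splits)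
      ultimately show False using a(1) b(2) by (auto simp: standard_pairs_def)
    qed
  }
  assume P: "?P \<rho>'"
  \<comment> \<open>A maximal set among those containing \<rho>' and avoiding the initial ideal
    becomes the free set: its maximality is the third condition on a standard pair.\<close>
  define \<Sigma> where "\<Sigma> = {\<sigma>. \<rho>' \<subseteq> \<sigma> \<and> ?P \<sigma>}"
  have "finite \<Sigma>" "\<Sigma> \<noteq> {}" using P by (auto simp: \<Sigma>_def)
  then obtain \<sigma> where "\<sigma> \<in> \<Sigma>" and max: "\<forall>\<sigma>'\<in>\<Sigma>. \<sigma> \<subseteq> \<sigma>' \<longrightarrow> \<sigma> = \<sigma>'"
    using finite_has_maximal[of \<Sigma>] by blast
  then have \<sigma>: "\<rho>' \<subseteq> \<sigma>" "?P \<sigma>" by (auto simp: \<Sigma>_def)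
  have nc: "- \<sigma> \<subseteq> nat_coords v" using assms(1) \<sigma>(1) by blast
  have "\<exists>b. keys b \<subseteq> insert l \<sigma> \<and> pmon (nat_part v (- \<sigma>) + b) \<in> ?M" if l: "l \<notin> \<sigma>" for l
  proof -
    have "insert l \<sigma> \<notin> \<Sigma>" using max l by blast
    then have "\<not> ?P (insert l \<sigma>)" using \<sigma>(1) by (auto simp: \<Sigma>_def)
    then obtain b where b: "keys b \<subseteq> insert l \<sigma>" "pmon (nat_part v (- insert l \<sigma>) + b) \<in> ?M"
      by blast
    have "insert l (- insert l \<sigma>) = - \<sigma>" using l by blast
    then obtain c where c: "nat_part v (- \<sigma>) = nat_part v (- insert l \<sigma>) + c"
      using nat_part_insert[of l "- insert l \<sigma>" v] by auto
    show ?thesis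
      using up[OF b(2), of c] b(1) unfolding c by (intro exI[of _ b]) (simp add: ac_simps)
  qed
  then have "(nat_part v (- \<sigma>), \<sigma>) \<in> std_pairs_at A w v"
    using \<sigma>(2) lookup_nat_part[OF nc] by (auto simp: std_pairs_at_def standard_pairs_def)
  then show "\<rho> \<in> Delta A w v"
    using \<sigma>(1) assms(1) by (auto simp: Delta_def)
qed

section \<open>Negative supports and the faces of the link\<close>

lemma nsupp_subset: "nsupp v \<subseteq> - nat_coords v"
proof
  fix j assume "j \<in> nsupp v"
  then obtain k :: int where k: "k < 0" "v $ j = of_int k" by (auto simp: nsupp_def)
  have False if "v $ j = of_nat n" for n
  proof -
    have "of_int k = (of_int (int n) :: complex)" using k(2) that by simp
    then show False using k(1) by (simp only: of_int_eq_iff)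
  qed
  then show "j \<in> - nat_coords v" by (auto simp: nat_coords_def Nats_def)
qed

text \<open>\<open>Delta A w v\<close> is closed under subsets, so \<tau> belongs to it as soon as
  its union with \<open>nsupp v\<close> does.\<close>

lemma link_iff:
  "\<tau> \<in> link A w v \<longleftrightarrow> \<tau> \<inter> nsupp v = {} \<and> \<tau> \<union> nsupp v \<in> Delta A w v"
  unfolding link_def Delta_def by fastforce

text \<open>Where \<open>v\<close> takes a natural value n, subtracting the difference of
  \<open>p\<close> and \<open>q\<close> gives a negative integer iff n is less than the exponent of
  \<open>p\<close>: if that exponent is positive, the one of \<open>q\<close> is 0 by disjointness,
  and otherwise nothing is lost. Non-integral coordinates stay non-integral and negative ones are
  removed from \<open>G_set\<close>, so only natural coordinates outside \<tau> have to be
  tested.\<close>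

lemma G_set_subset_iff:
  assumes disj: "\<And>j. lookup p j = 0 \<or> lookup q j = 0" and S: "- S \<subseteq> nat_coords v" "S = \<tau> \<union> - nat_coords v"
  shows "G_set v p q \<subseteq> \<tau> \<longleftrightarrow> (\<forall>j. j \<notin> S \<longrightarrow> lookup p j \<le> lookup (nat_part v (- S)) j)"
proof -
  have mem: "j \<in> G_set v p q \<longleftrightarrow> n < lookup p j" if "v $ j = of_nat n" for j n
  proof -
    have "j \<notin> nsupp v" using that nsupp_subset by (fastforce simp: nat_coords_def)
    moreover have "nsupp_shift v 0 = nsupp v" by (simp add: nsupp_shift_def nsupp_def)
    ultimately have "j \<in> G_set v p q \<longleftrightarrow>
        (\<exists>k<0. of_int (int n - (int (lookup p j) - int (lookup q j))) = (of_int k :: complex))"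
      using that by (simp add: G_set_def nsupp_shift_def nsupp_def algebra_simps)
    also have "\<dots> \<longleftrightarrow> int n - (int (lookup p j) - int (lookup q j)) < 0"
      by (simp only: of_int_eq_iff) auto
    also have "\<dots> \<longleftrightarrow> n < lookup p j" using disj[of j] by auto
    finally show ?thesis .
  qed
  have "G_set v p q \<subseteq> nat_coords v"
  proof
    fix j assume j: "j \<in> G_set v p q"
    then obtain k :: int where "v $ j - of_int (int (lookup p j) - int (lookup q j)) = of_int k"
      by (auto simp: G_set_def nsupp_shift_def nsupp_def algebra_simps)
    then have k: "v $ j = of_int (k + (int (lookup p j) - int (lookup q j)))"
      by (simp only: of_int_add) (simp add: algebra_simps)
    have "nsupp_shift v 0 = nsupp v" by (simp add: nsupp_shift_def nsupp_def)
    then have "j \<notin> nsupp v" using j by (simp add: G_set_def)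
    then have "0 \<le> k + (int (lookup p j) - int (lookup q j))"
      using k unfolding nsupp_def by (metis (mono_tags, lifting) linorder_not_le mem_Collect_eq)
    then obtain n where "k + (int (lookup p j) - int (lookup q j)) = int n"
      using zero_le_imp_eq_int by blast
    then show "j \<in> nat_coords v" using k by (simp add: nat_coords_def)
  qed
  then have "G_set v p q \<subseteq> \<tau> \<longleftrightarrow> (\<forall>j. j \<notin> S \<longrightarrow> j \<notin> G_set v p q)"
    using S(2) by blast
  also have "\<dots> \<longleftrightarrow> (\<forall>j. j \<notin> S \<longrightarrow> lookup p j \<le> lookup (nat_part v (- S)) j)"
    using mem lookup_nat_part(1)[OF S(1)] by (meson ComplI not_le)
  finally show ?thesis .
qed

lemma link_iff_G_set:
  fixes A :: "int^'n::finite^'d" and m :: nat and gp gm :: "nat \<Rightarrow> 'n \<Rightarrow>\<^sub>0 nat"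
  assumes groebner: "reduced_groebner_basis w (toric_ideal A)
          ((\<lambda>i. pmon (gp i) - pmon (gm i)) ` {1..m})"
    and \<tau>: "\<tau> \<inter> nsupp v = {}"
  shows "\<tau> \<in> link A w v \<longleftrightarrow> \<not> (\<exists>i\<in>{1..m}. G_set v (gp i) (gm i) \<subseteq> \<tau>)"
proof -
  define S where "S = \<tau> \<union> - nat_coords v"
  have nc: "- S \<subseteq> nat_coords v" by (auto simp: S_def)
  have "\<tau> \<in> link A w v \<longleftrightarrow> \<tau> \<union> nsupp v \<in> Delta A w v"
    using \<tau> by (simp add: link_iff)
  also have "\<dots> \<longleftrightarrow>
      (\<forall>b. keys b \<subseteq> S \<longrightarrow> pmon (nat_part v (- S) + b) \<notin> initial_ideal w (toric_ideal A))"
    using nsupp_subset by (intro Delta_iff) (auto simp: S_def)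
  also have "\<dots> \<longleftrightarrow> \<not> (\<exists>i\<in>{1..m}. \<forall>j. j \<notin> S \<longrightarrow> lookup (gp i) j \<le> lookup (nat_part v (- S)) j)"
  proof -
    \<comment> \<open>The exponents on \<open>S\<close> are unrestricted, so divisibility by a
      leading term is decided outside \<open>S\<close>; the witness copies \<open>p\<close> on
      \<open>S\<close>.\<close>
    have "(\<exists>b. keys b \<subseteq> S \<and> (\<forall>j. lookup p j \<le> lookup (nat_part v (- S) + b) j)) \<longleftrightarrow>
        (\<forall>j. j \<notin> S \<longrightarrow> lookup p j \<le> lookup (nat_part v (- S)) j)" (is "?L \<longleftrightarrow> ?R") for p
    proof
      assume ?L
      then show ?R by (metis add.right_neutral in_keys_iff lookup_add subsetD)
    next
      assume R: ?R
      define b where "b = (\<Sum>j\<in>S. Poly_Mapping.single j (lookup p j))"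
      have b: "lookup b j = (if j \<in> S then lookup p j else 0)" for j
        by (simp add: b_def lookup_sum lookup_single when_def)
      show ?L
        using R by (intro exI[of _ b]) (auto simp: in_keys_iff b lookup_add split: if_splits)
    qed
    then show ?thesis
      unfolding pmon_in_groebner_initial_ideal_iff[OF groebner] by blast
  qed
  also have "\<dots> \<longleftrightarrow> \<not> (\<exists>i\<in>{1..m}. G_set v (gp i) (gm i) \<subseteq> \<tau>)"
    using G_set_subset_iff[OF groebner_disjoint_supports[OF groebner] nc S_def] by simp
  finally show ?thesis .
qed

section \<open>Elimination of variables\<close>

context
  fixes V :: "'n set"
begin

lemma poly_carrier_add:
    "p \<in> carrier (poly_ring V) \<Longrightarrow> q \<in> carrier (poly_ring V) \<Longrightarrow> p + q \<in> carrier (poly_ring V)"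
  and poly_carrier_mult:
    "p \<in> carrier (poly_ring V) \<Longrightarrow> q \<in> carrier (poly_ring V) \<Longrightarrow> p * q \<in> carrier (poly_ring V)"
proof -
  interpret cring "poly_ring V" by (rule cring_poly_ring)
  show "p \<in> carrier (poly_ring V) \<Longrightarrow> q \<in> carrier (poly_ring V) \<Longrightarrow> p + q \<in> carrier (poly_ring V)"
    and "p \<in> carrier (poly_ring V) \<Longrightarrow> q \<in> carrier (poly_ring V) \<Longrightarrow> p * q \<in> carrier (poly_ring V)"
    using a_closed[of p q] m_closed[of p q] by (simp_all only: poly_ring_simps(4,5))
qed

lemma poly_carrier_diff:
  "p \<in> carrier (poly_ring V) \<Longrightarrow> q \<in> carrier (poly_ring V) \<Longrightarrow> p - q \<in> carrier (poly_ring V)"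
  using poly_carrier_add[of p "- q"] by simp

lemma poly_carrier_const: "pconst c \<in> carrier (poly_ring V)"
  using keys_pconst[of c] by auto

lemma poly_carrier_pvar: "j \<in> V \<Longrightarrow> pvar j \<in> carrier (poly_ring V)"
  by simp

lemma poly_carrier_power: "p \<in> carrier (poly_ring V) \<Longrightarrow> p ^ n \<in> carrier (poly_ring V)"
proof (induction n)
  case (Suc n)
  then show ?case unfolding power_Suc by (intro poly_carrier_mult)
qed simp

lemma poly_carrier_prod:
  assumes "\<And>i. i \<in> S \<Longrightarrow> f i \<in> carrier (poly_ring V)"
  shows "prod f S \<in> carrier (poly_ring V)"
  using assms
proof (induction S rule: infinite_finite_induct)
  case (insert x F)
  then show ?case unfolding prod.insert[OF insert(1,2)] by (intro poly_carrier_mult) blast+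
qed simp_all

lemma poly_carrier_sum:
  assumes "\<And>i. i \<in> S \<Longrightarrow> f i \<in> carrier (poly_ring V)"
  shows "sum f S \<in> carrier (poly_ring V)"
  using assms
proof (induction S rule: infinite_finite_induct)
  case (insert x F)
  then show ?case unfolding sum.insert[OF insert(1,2)] by (intro poly_carrier_add) blast+
qed simp_all

end

section \<open>Homogeneous polynomials and linear substitutions\<close>

lemma homog_partI:
  assumes "\<And>u. u \<in> keys p \<Longrightarrow> keys u \<subseteq> V \<and> (\<Sum>j\<in>UNIV. lookup u j) = k"
  shows "p \<in> homog_part V k"
  using assms by (simp add: homog_part_def)

lemma homog_part_add: "p \<in> homog_part V k \<Longrightarrow> q \<in> homog_part V k \<Longrightarrow> p + q \<in> homog_part V k"
  using Poly_Mapping.keys_add[of p q] by (fastforce simp: homog_part_def)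

lemma homog_part_zero: "0 \<in> homog_part V k"
  by (simp add: homog_part_def)

lemma homog_part_sum: "(\<And>i. i \<in> S \<Longrightarrow> f i \<in> homog_part V k) \<Longrightarrow> sum f S \<in> homog_part V k"
  by (induction S rule: infinite_finite_induct) (auto simp: homog_part_zero homog_part_add)

lemma homog_part_mult:
  assumes p: "p \<in> homog_part V k" and q: "q \<in> homog_part V l"
  shows "p * q \<in> homog_part V (k + l)"
proof (rule homog_partI)
  fix u assume "u \<in> keys (p * q)"
  then obtain a b where "u = a + b" "a \<in> keys p" "b \<in> keys q" by (rule keys_multE)
  then show "keys u \<subseteq> V \<and> (\<Sum>j\<in>UNIV. lookup u j) = k + l"
    using p q Poly_Mapping.keys_add[of a b]
    by (fastforce simp: homog_part_def lookup_add sum.distrib)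
qed

lemma homog_part_const: "pconst c \<in> homog_part V 0"
  using keys_pconst[of c] by (intro homog_partI) auto

lemma homog_part_pvar: "j \<in> V \<Longrightarrow> pvar j \<in> homog_part V 1"
  by (intro homog_partI) (auto simp: lookup_single when_def)

lemma homog_part_one: "1 \<in> homog_part V 0"
  using homog_part_const[of 1 V] by simp

lemma homog_part_power: "p \<in> homog_part V k \<Longrightarrow> p ^ n \<in> homog_part V (n * k)"
  by (induction n) (auto simp: homog_part_one intro: homog_part_mult)

lemma homog_part_prod:
  "(\<And>i. i \<in> S \<Longrightarrow> f i \<in> homog_part V (d i)) \<Longrightarrow> prod f S \<in> homog_part V (sum d S)"
  by (induction S rule: infinite_finite_induct) (auto simp: homog_part_one intro: homog_part_mult)

lemma linear_form_in_homog_part: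
  assumes "linear_form_in V p"
  shows "p \<in> homog_part V 1"
proof -
  obtain c where p: "p = (\<Sum>j\<in>V. pconst (c j) * pvar j)"
    using assms by (auto simp: linear_form_in_def)
  have "pconst (c j) * pvar j \<in> homog_part V 1" if "j \<in> V" for j
    using homog_part_mult[OF homog_part_const homog_part_pvar[OF that]] by simp
  then show ?thesis unfolding p by (rule homog_part_sum)
qed

text \<open>A monomial of degree \<open>k\<close> turns into a product of \<open>k\<close> forms of
  degree 1.\<close>

lemma subst_homog_part:
  assumes h: "\<And>j. h j \<in> homog_part V 1" and p: "p \<in> homog_part W k"
  shows "subst h p \<in> homog_part V k"
proof -
  have "pconst (lookup p u) * (\<Prod>j\<in>UNIV. h j ^ lookup u j) \<in> homog_part V k" if u: "u \<in> keys p" for u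
  proof -
    have prod: "(\<Prod>j\<in>UNIV. h j ^ lookup u j) \<in> homog_part V (\<Sum>j\<in>UNIV. lookup u j * 1)"
      by (intro homog_part_prod homog_part_power h)
    have deg: "(\<Sum>j\<in>UNIV. lookup u j * 1) = k" using p u by (simp add: homog_part_def)
    show ?thesis
      using homog_part_mult[OF homog_part_const prod, of "lookup p u"] unfolding deg add_0 .
  qed
  then show ?thesis unfolding subst_def mpol_ext_def by (rule homog_part_sum)
qed

section \<open>Substitution modulo an ideal\<close>

lemma subst_carrier:
  assumes "\<And>j. h j \<in> carrier (poly_ring V)"
  shows "subst h p \<in> carrier (poly_ring V)"
  unfolding subst_def mpol_ext_def using assms
  by (intro poly_carrier_sum poly_carrier_mult poly_carrier_prod poly_carrier_power poly_carrier_const)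

text \<open>Modulo \<open>Q\<close> each variable in \<open>V\<close> equals its image, and
  congruence modulo an ideal is compatible with powers, products and linear combinations.\<close>

lemma subst_congruent:
  assumes Q: "ideal Q (poly_ring V)" and h: "\<And>j. j \<in> V \<Longrightarrow> pvar j - h j \<in> Q"
    and p: "p \<in> carrier (poly_ring V)"
  shows "p - subst h p \<in> Q"
proof -
  let ?C = "carrier (poly_ring V)"
  have mult: "a * b - c * d \<in> Q" if "a - c \<in> Q" "b - d \<in> Q" "a \<in> ?C" "d \<in> ?C" for a b c d
  proof -
    have "a * b - c * d = a * (b - d) + d * (a - c)" by (simp add: algebra_simps)
    then show ?thesis using that by (auto intro: ideal_add[OF Q] ideal_mult[OF Q])
  qed
  have pvar: "pvar j \<in> ?C" if "j \<in> V" for j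
    using that by (rule poly_carrier_pvar)
  have hC: "h j \<in> ?C" if "j \<in> V" for j
    using poly_carrier_diff[OF pvar[OF that] ideal.Icarr[OF Q h[OF that]]] by simp
  have power: "pvar j ^ n - h j ^ n \<in> Q" if "j \<in> V" for j n
  proof (induction n)
    case (Suc n)
    show ?case
      unfolding power_Suc using that by (intro mult Suc h pvar poly_carrier_power hC)
  qed (simp add: ideal_zero[OF Q])
  have prod: "(\<Prod>j\<in>S. pvar j ^ f j) - (\<Prod>j\<in>S. h j ^ f j) \<in> Q" if "S \<subseteq> V" for S f
    using finite[of S] that
  proof (induction S rule: finite_induct)
    case (insert j S)
    have "pvar j ^ f j * (\<Prod>j\<in>S. pvar j ^ f j) - h j ^ f j * (\<Prod>j\<in>S. h j ^ f j) \<in> Q"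
      using insert by (intro mult power poly_carrier_prod poly_carrier_power pvar hC) auto
    then show ?case using insert by simp
  qed (simp add: ideal_zero[OF Q])
  have term_diff: "pmon u - (\<Prod>j\<in>UNIV. h j ^ lookup u j) \<in> Q" if "u \<in> keys p" for u
  proof -
    have "lookup u j = 0" if "j \<notin> V" for j
      using p \<open>u \<in> keys p\<close> that by (metis in_keys_iff poly_ring_simps(1) subsetD)
    then have "(\<Prod>j\<in>UNIV. g j ^ lookup u j) = (\<Prod>j\<in>V. g j ^ lookup u j)" for g :: "'a \<Rightarrow> 'a mpol"
      by (intro prod.mono_neutral_right) auto
    then show ?thesis using prod[of V "lookup u"] by (simp add: pmon_eq_prod)
  qed
  have "(\<Sum>u\<in>keys p. pconst (lookup p u) * (pmon u - (\<Prod>j\<in>UNIV. h j ^ lookup u j))) \<in> Q"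
    using term_diff poly_carrier_const[of _ V]
    by (intro ideal_sum[OF Q] ideal_mult[OF Q]) auto
  moreover have "p = (\<Sum>u\<in>keys p. pconst (lookup p u) * pmon u)"
    by (simp add: mpol_eq_sum flip: single_eq_pconst_pmon)
  then have "p - subst h p =
      (\<Sum>u\<in>keys p. pconst (lookup p u) * (pmon u - (\<Prod>j\<in>UNIV. h j ^ lookup u j)))"
    by (simp add: subst_def mpol_ext_def right_diff_distrib sum_subtractf)
  ultimately show ?thesis by simp
qed

lemma ideal_restrict:
  assumes Q: "ideal Q (poly_ring UNIV)"
  shows "ideal (Q \<inter> carrier (poly_ring V)) (poly_ring V)"
proof (rule ideal_poly_ringI)
  fix p q assume "p \<in> Q \<inter> carrier (poly_ring V)" "q \<in> Q \<inter> carrier (poly_ring V)"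
  then show "p + q \<in> Q \<inter> carrier (poly_ring V)"
    using ideal_add[OF Q] poly_carrier_add by blast
next
  fix p q :: "'a mpol"
  assume "\<forall>u\<in>keys p. keys u \<subseteq> V" "q \<in> Q \<inter> carrier (poly_ring V)"
  moreover from this have "p \<in> carrier (poly_ring V)" unfolding poly_ring_simps by blast
  ultimately show "p * q \<in> Q \<inter> carrier (poly_ring V)"
    using ideal_mult[OF Q, of p q] poly_carrier_mult by blast
qed (use ideal_zero[OF Q] in auto)

section \<open>Isomorphisms between quotient rings\<close>

lemma FactRing_carrierE:
  assumes "X \<in> carrier (R Quot I)"
  obtains x where "x \<in> carrier R" "X = I +>\<^bsub>R\<^esub> x"
  using assms by (auto simp: FactRing_def A_RCOSETS_def')

text \<open>The first isomorphism theorem, in a form that records the value on each coset; the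
  action on constants and on homogeneous parts is read off from these values.\<close>

lemma factor_iso_exists:
  assumes "ring_hom_ring T S h" "h ` carrier T = carrier S" "a_kernel T S h = Q"
  shows "\<exists>\<phi>\<in>ring_iso (T Quot Q) S. \<forall>p\<in>carrier T. \<phi> (Q +>\<^bsub>T\<^esub> p) = h p"
proof -
  interpret ring_hom_ring T S h by fact
  let ?\<phi> = "\<lambda>X. the_elem (h ` X)"
  have "?\<phi> \<in> ring_iso (T Quot Q) S"
    using FactRing_iso_set[OF assms(2)] unfolding assms(3) .
  moreover have "?\<phi> (Q +>\<^bsub>T\<^esub> p) = h p" if "p \<in> carrier T" for p
    using the_elem_simp[OF that] unfolding assms(3) .
  ultimately show ?thesis by (intro bexI[of _ ?\<phi>] ballI)
qed

text \<open>The last assumption says that \<open>Q\<close> is generated by the differences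
  \<open>\<theta>\<^sub>j - h\<^sub>j\<close> together with \<open>I\<close> and \<open>S\<close>.\<close>

lemma quotient_by_elimination:
  fixes h :: "'n::finite \<Rightarrow> 'n mpol" and V :: "'n set" and I S Q :: "'n mpol set"
  defines "P \<equiv> poly_ring V" and "T \<equiv> poly_ring UNIV"
  defines "R \<equiv> P Quot I"
  defines "J \<equiv> Idl\<^bsub>R\<^esub> ((+>\<^bsub>P\<^esub>) I ` S)"
  assumes h_carrier: "\<And>j. h j \<in> carrier P" and h_id: "\<And>j. j \<in> V \<Longrightarrow> h j = pvar j"
    and I: "ideal I P" and S: "S \<subseteq> carrier P"
    and Q: "ideal Q T" "\<And>j. pvar j - h j \<in> Q" "I \<subseteq> Q" "S \<subseteq> Q"
    and Q_minimal: "\<And>K. ideal K T \<Longrightarrow> (\<forall>j. pvar j - h j \<in> K) \<Longrightarrow> I \<subseteq> K \<Longrightarrow> S \<subseteq> K \<Longrightarrow> Q \<subseteq> K"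
  shows "\<exists>\<phi>\<in>ring_iso (T Quot Q) (R Quot J).
    \<forall>p. \<phi> (Q +>\<^bsub>T\<^esub> p) = J +>\<^bsub>R\<^esub> (I +>\<^bsub>P\<^esub> subst h p)"
proof -
  interpret P: cring P unfolding P_def by (rule cring_poly_ring)
  interpret T: cring T unfolding T_def by (rule cring_poly_ring)
  interpret I: ideal I P by (rule I)
  interpret R: ring R unfolding R_def by (rule I.quotient_is_ring)
  interpret c: ring_hom_ring P R "(+>\<^bsub>P\<^esub>) I" unfolding R_def by (rule I.rcos_ring_hom_ring)
  have genJ: "(+>\<^bsub>P\<^esub>) I ` S \<subseteq> carrier R" using S by auto
  interpret J: ideal J R unfolding J_def using genJ by (rule R.genideal_ideal)
  have carrier_T: "p \<in> carrier T" for p by (simp add: T_def)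
  have subst_P: "subst h p \<in> carrier P" for p
    using subst_carrier[of h V] h_carrier unfolding P_def by blast
  have subst_id: "subst h p = p" if "p \<in> carrier P" for p
    using that h_id by (intro subst_cong_vars[of _ V]) (auto simp: P_def)
  interpret \<psi>: ring_hom_ring T P "subst h"
    by (rule ring_hom_ringI)
      (use subst_P in \<open>auto simp: T_def P_def ring_poly_ring subst_add subst_mult subst_one\<close>)
  have c\<psi>: "ring_hom_ring T R ((+>\<^bsub>P\<^esub>) I \<circ> subst h)"
    by (rule ring_hom_ringI2[OF T.ring_axioms R.ring_axioms ring_hom_trans[OF \<psi>.homh c.homh]])
  have hom: "ring_hom_ring T (R Quot J) ((+>\<^bsub>R\<^esub>) J \<circ> ((+>\<^bsub>P\<^esub>) I \<circ> subst h))"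
    by (rule ring_hom_ringI2[OF T.ring_axioms J.quotient_is_ring
          ring_hom_trans[OF ring_hom_ring.homh[OF c\<psi>] J.rcos_ring_hom]])
  have surj: "((+>\<^bsub>R\<^esub>) J \<circ> ((+>\<^bsub>P\<^esub>) I \<circ> subst h)) ` carrier T = carrier (R Quot J)"
  proof
    show "((+>\<^bsub>R\<^esub>) J \<circ> ((+>\<^bsub>P\<^esub>) I \<circ> subst h)) ` carrier T \<subseteq> carrier (R Quot J)"
      using ring_hom_closed[OF ring_hom_ring.homh[OF hom]] by blast
    show "carrier (R Quot J) \<subseteq> ((+>\<^bsub>R\<^esub>) J \<circ> ((+>\<^bsub>P\<^esub>) I \<circ> subst h)) ` carrier T"
    proof
      fix Y assume "Y \<in> carrier (R Quot J)"
      then obtain X where X: "X \<in> carrier R" "Y = J +>\<^bsub>R\<^esub> X"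
        by (rule FactRing_carrierE)
      then obtain p where p: "p \<in> carrier P" "X = I +>\<^bsub>P\<^esub> p"
        unfolding R_def by (meson FactRing_carrierE)
      show "Y \<in> ((+>\<^bsub>R\<^esub>) J \<circ> ((+>\<^bsub>P\<^esub>) I \<circ> subst h)) ` carrier T"
        unfolding X(2) p(2) using carrier_T[of p] subst_id[OF p(1)]
        by (intro image_eqI[of _ _ p]) (simp_all only: o_apply)
    qed
  qed
  have ker: "p \<in> a_kernel T (R Quot J) ((+>\<^bsub>R\<^esub>) J \<circ> ((+>\<^bsub>P\<^esub>) I \<circ> subst h))
      \<longleftrightarrow> I +>\<^bsub>P\<^esub> subst h p \<in> J" for p
  proof -
    let ?X = "I +>\<^bsub>P\<^esub> subst h p"
    have "?X \<in> carrier R" using subst_P by simp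
    then have "J +>\<^bsub>R\<^esub> ?X = J \<longleftrightarrow> ?X \<in> J"
      using J.a_rcos_const[of ?X] J.a_rcos_self[of ?X] by blast
    moreover have "\<zero>\<^bsub>R Quot J\<^esub> = J" by (simp add: FactRing_def)
    ultimately show ?thesis
      unfolding a_kernel_def' using carrier_T[of p] by (simp only: mem_Collect_eq o_apply simp_thms)
  qed
  have "a_kernel T (R Quot J) ((+>\<^bsub>R\<^esub>) J \<circ> ((+>\<^bsub>P\<^esub>) I \<circ> subst h)) = Q"
  proof
    let ?K = "{p \<in> carrier T. ((+>\<^bsub>P\<^esub>) I \<circ> subst h) p \<in> J}"
    have zero: "I +>\<^bsub>P\<^esub> q \<in> J" if "q \<in> I" for q
    proof -
      have "I +>\<^bsub>P\<^esub> q = \<zero>\<^bsub>R\<^esub>"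
        unfolding I.a_rcos_const[OF that] R_def FactRing_def by simp
      then show ?thesis using J.zero_closed by metis
    qed
    \<comment> \<open>The kernel is an ideal containing the generators of \<open>Q\<close>. The
      differences \<open>pvar j - h j\<close> are killed because \<open>h j\<close> involves only
      variables in \<open>V\<close>, which the substitution fixes.\<close>
    have "Q \<subseteq> ?K"
    proof (rule Q_minimal)
      show "ideal ?K T" by (rule ring_hom_ring.ideal_vimage[OF c\<psi> J.ideal_axioms])
      have 0: "0 \<in> I" using I.zero_closed unfolding P_def poly_ring_simps .
      have "subst h (pvar j - h j) = 0" for j
        unfolding subst_diff subst_pvar subst_id[OF h_carrier] by simp
      then show "\<forall>j. pvar j - h j \<in> ?K"
        using zero[OF 0] carrier_T unfolding o_apply by (metis (mono_tags, lifting) mem_Collect_eq)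
      show "I \<subseteq> ?K"
        using zero subst_id[OF I.Icarr] carrier_T by (intro subsetI CollectI conjI) (simp_all only: o_apply)
      show "S \<subseteq> ?K"
      proof (intro subsetI CollectI conjI)
        fix x assume "x \<in> S"
        then have "subst h x = x" "I +>\<^bsub>P\<^esub> x \<in> J"
          using S subst_id R.genideal_self[OF genJ] unfolding J_def by blast+
        then show "((+>\<^bsub>P\<^esub>) I \<circ> subst h) x \<in> J" unfolding o_apply by metis
      qed (rule carrier_T)
    qed
    then show "Q \<subseteq> a_kernel T (R Quot J) ((+>\<^bsub>R\<^esub>) J \<circ> ((+>\<^bsub>P\<^esub>) I \<circ> subst h))"
    proof (intro subsetI)
      fix p assume "p \<in> Q"
      with \<open>Q \<subseteq> ?K\<close> have "p \<in> ?K" by (rule subsetD)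
      then have "I +>\<^bsub>P\<^esub> subst h p \<in> J" unfolding mem_Collect_eq o_apply by (rule conjunct2)
      then show "p \<in> a_kernel T (R Quot J) ((+>\<^bsub>R\<^esub>) J \<circ> ((+>\<^bsub>P\<^esub>) I \<circ> subst h))"
        by (rule ker[THEN iffD2])
    qed
    \<comment> \<open>For the other inclusion, the image of this contraction in \<open>R\<close> is
      an ideal containing the generators of \<open>J\<close>, hence contains \<open>J\<close>. So
      for \<open>p\<close> in the kernel, \<open>subst h p\<close> differs from an element of
      \<open>Q\<close> by an element of \<open>I\<close>, and \<open>p\<close> is congruent to
      \<open>subst h p\<close> modulo \<open>Q\<close>.\<close>
    let ?Q = "Q \<inter> carrier P"
    have Q': "ideal Q (poly_ring UNIV)" using Q(1) unfolding T_def .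
    have "ideal ?Q P" unfolding P_def by (rule ideal_restrict[OF Q'])
    then have "ideal ((+>\<^bsub>P\<^esub>) I ` ?Q) R"
      unfolding R_def by (rule P.ring_ideal_imp_quot_ideal[OF I])
    then have J_sub: "J \<subseteq> (+>\<^bsub>P\<^esub>) I ` ?Q"
      unfolding J_def using Q(4) S by (intro R.genideal_minimal image_mono) blast+
    show "a_kernel T (R Quot J) ((+>\<^bsub>R\<^esub>) J \<circ> ((+>\<^bsub>P\<^esub>) I \<circ> subst h)) \<subseteq> Q"
    proof
      fix p assume "p \<in> a_kernel T (R Quot J) ((+>\<^bsub>R\<^esub>) J \<circ> ((+>\<^bsub>P\<^esub>) I \<circ> subst h))"
      then obtain q where q: "q \<in> ?Q" "I +>\<^bsub>P\<^esub> subst h p = I +>\<^bsub>P\<^esub> q"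
        using J_sub ker[THEN iffD1] by blast
      have "subst h p \<in> I +>\<^bsub>P\<^esub> q"
        using I.a_rcos_self[OF subst_P, of p] unfolding q(2) .
      then obtain i where i: "i \<in> I" "subst h p = i \<oplus>\<^bsub>P\<^esub> q"
        unfolding a_r_coset_def' by blast
      have "subst h p \<in> Q"
        using ideal_add[OF Q'] i(1) q(1) Q(3) unfolding i(2) P_def poly_ring_simps(4) by blast
      moreover have "p - subst h p \<in> Q"
        using carrier_T[of p] unfolding T_def by (rule subst_congruent[OF Q' Q(2)])
      ultimately show "p \<in> Q"
        using ideal_add[OF Q'] diff_add_cancel[of p "subst h p"] by metis
    qed
  qed
  from factor_iso_exists[OF hom surj this] obtain \<phi> where \<phi>: "\<phi> \<in> ring_iso (T Quot Q) (R Quot J)"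
    and eq: "\<forall>p\<in>carrier T. \<phi> (Q +>\<^bsub>T\<^esub> p) = ((+>\<^bsub>R\<^esub>) J \<circ> ((+>\<^bsub>P\<^esub>) I \<circ> subst h)) p"
    by (elim bexE)
  show ?thesis
  proof (intro bexI[of _ \<phi>] allI \<phi>)
    show "\<phi> (Q +>\<^bsub>T\<^esub> p) = J +>\<^bsub>R\<^esub> (I +>\<^bsub>P\<^esub> subst h p)" for p
      using bspec[OF eq carrier_T[of p]] unfolding o_apply .
  qed
qed

section \<open>Krull dimension of Stanley--Reisner rings\<close>

lemma primeideal_prod_pvar:
  assumes P: "primeideal P (poly_ring V)" and S: "finite S" "S \<subseteq> V" "(\<Prod>j\<in>S. pvar j) \<in> P"
  shows "\<exists>j\<in>S. pvar j \<in> P"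
  using S
proof (induction S rule: finite_induct)
  case empty
  interpret primeideal P "poly_ring V" by (rule P)
  have "\<one>\<^bsub>poly_ring V\<^esub> \<in> P" using empty by simp
  then show ?case using one_imp_carrier I_notcarr by simp
next
  case (insert j S)
  interpret primeideal P "poly_ring V" by (rule P)
  have "pvar j \<in> carrier (poly_ring V)" "(\<Prod>j\<in>S. pvar j) \<in> carrier (poly_ring V)"
    using insert.prems by (auto simp: intro!: poly_carrier_prod poly_carrier_pvar simp del: poly_ring_simps(1))
  then have "pvar j \<in> P \<or> (\<Prod>j\<in>S. pvar j) \<in> P"
    using I_prime[of "pvar j" "\<Prod>j\<in>S. pvar j"] insert by simp
  then show ?case using insert by auto
qed

text \<open>Turns bounds between numbers of monomials into bounds between numbers of variables. If
  \<open>m\<close> exceeded \<open>t\<close>, the value \<open>N = (K + 1) ^ t\<close> would violate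
  the inequality, since the right-hand side is then at most \<open>N * (N + 1) ^ t\<close>.\<close>

lemma power_growth:
  assumes "\<And>N::nat. (N + 1) ^ m \<le> (K * N + 1) ^ t"
  shows "m \<le> t"
proof (rule ccontr)
  assume "\<not> m \<le> t"
  then have m: "Suc t \<le> m" by simp
  define N where "N = (K + 1) ^ t"
  have "(N + 1) ^ Suc t \<le> (N + 1) ^ m" using m by (intro power_increasing) auto
  also have "\<dots> \<le> (K * N + 1) ^ t" by (rule assms)
  also have "\<dots> \<le> ((K + 1) * (N + 1)) ^ t" by (intro power_mono) (auto simp: algebra_simps)
  also have "\<dots> = N * (N + 1) ^ t" by (simp only: power_mult_distrib N_def)
  finally have "(N + 1) * (N + 1) ^ t \<le> N * (N + 1) ^ t" by simp
  then show False by simp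
qed

lemma card_bounded_exponents:
  fixes \<tau> :: "'n::finite set"
  shows "finite {u :: 'n \<Rightarrow>\<^sub>0 nat. keys u \<subseteq> \<tau> \<and> (\<forall>j. lookup u j \<le> K)}"
    and "card {u :: 'n \<Rightarrow>\<^sub>0 nat. keys u \<subseteq> \<tau> \<and> (\<forall>j. lookup u j \<le> K)} = (K + 1) ^ card \<tau>"
proof -
  let ?B = "{u :: 'n \<Rightarrow>\<^sub>0 nat. keys u \<subseteq> \<tau> \<and> (\<forall>j. lookup u j \<le> K)}"
  have bij: "bij_betw (\<lambda>u. restrict (lookup u) \<tau>) ?B (\<tau> \<rightarrow>\<^sub>E {..K})"
  proof (rule bij_betwI[where g = "\<lambda>f. \<Sum>j\<in>\<tau>. Poly_Mapping.single j (f j)"])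
    have look: "lookup (\<Sum>j\<in>\<tau>. Poly_Mapping.single j (f j)) i = (if i \<in> \<tau> then f i else 0)"
      for f :: "'n \<Rightarrow> nat" and i
      by (simp add: lookup_sum lookup_single when_def)
    show "(\<lambda>f. \<Sum>j\<in>\<tau>. Poly_Mapping.single j (f j)) \<in> (\<tau> \<rightarrow>\<^sub>E {..K}) \<rightarrow> ?B"
      by (auto simp: look in_keys_iff PiE_iff split: if_splits)
    show "(\<Sum>j\<in>\<tau>. Poly_Mapping.single j (restrict (lookup u) \<tau> j)) = u" if "u \<in> ?B" for u
      using that by (intro poly_mapping_eqI) (auto simp: look in_keys_iff)
    show "restrict (lookup (\<Sum>j\<in>\<tau>. Poly_Mapping.single j (f j))) \<tau> = f"
      if "f \<in> \<tau> \<rightarrow>\<^sub>E {..K}" for f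
      using that by (auto simp: look PiE_iff extensional_def restrict_def)
  qed auto
  have PiE: "finite (\<tau> \<rightarrow>\<^sub>E {..K})" "card (\<tau> \<rightarrow>\<^sub>E {..K}) = (K + 1) ^ card \<tau>"
    by (simp_all add: finite_PiE card_PiE)
  show "finite ?B" using bij_betw_finite[OF bij] PiE(1) by blast
  show "card ?B = (K + 1) ^ card \<tau>" using bij_betw_same_card[OF bij] PiE(2) by (rule trans)
qed

text \<open>Reduction modulo the variables in \<open>Z\<close>, with the polynomial in the remaining
  variables as normal form.\<close>

definition kill_vars :: "'n::finite set \<Rightarrow> 'n mpol \<Rightarrow> 'n mpol"
  where "kill_vars Z = subst (\<lambda>j. if j \<in> Z then 0 else pvar j)"

lemma lookup_kill_vars:
  "lookup (kill_vars Z p) u = (if keys u \<inter> Z = {} then lookup p u else 0)"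
proof -
  have "(\<Prod>j\<in>UNIV. (if j \<in> Z then 0 else pvar j) ^ lookup u j) =
      (if keys u \<inter> Z = {} then pmon u else 0)" for u
  proof (cases "keys u \<inter> Z = {}")
    case True
    then have "(\<Prod>j\<in>UNIV. (if j \<in> Z then 0 else pvar j) ^ lookup u j) = pmon u"
      unfolding pmon_eq_prod by (intro prod.cong refl) (metis disjoint_iff in_keys_iff power_0)
    then show ?thesis using True by simp
  next
    case False
    then obtain j where "j \<in> Z" "lookup u j \<noteq> 0" by (auto simp: in_keys_iff)
    then have "(\<Prod>j\<in>UNIV. (if j \<in> Z then 0 else pvar j) ^ lookup u j) = 0"
      by (intro prod_zero bexI[of _ j]) (simp_all add: power_0_left)
    then show ?thesis using False by simp
  qed
  then have "kill_vars Z p =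
      (\<Sum>u\<in>keys p. Poly_Mapping.single u (if keys u \<inter> Z = {} then lookup p u else 0))"
    unfolding kill_vars_def subst_def mpol_ext_def
    by (intro sum.cong) (auto simp: single_eq_pconst_pmon)
  then show ?thesis by (auto simp: lookup_sum lookup_single when_def in_keys_iff)
qed

text \<open>Exponents are kept in a list so that induction along a chain of primes can split off the
  first element and shift the family \<open>f\<close>.\<close>

fun list_monomial :: "(nat \<Rightarrow> 'a::comm_monoid_mult) \<Rightarrow> nat list \<Rightarrow> 'a" where
  "list_monomial f [] = 1"
| "list_monomial f (x # xs) = f 0 ^ x * list_monomial (f \<circ> Suc) xs"

lemma list_monomial_carrier:
  assumes "\<And>i. i < length xs \<Longrightarrow> f i \<in> carrier (poly_ring V)"
  shows "list_monomial f xs \<in> carrier (poly_ring V)"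
  using assms
proof (induction xs arbitrary: f)
  case (Cons x xs)
  have "f 0 \<in> carrier (poly_ring V)" using Cons.prems by (metis length_greater_0_conv list.distinct(1))
  moreover have "list_monomial (f \<circ> Suc) xs \<in> carrier (poly_ring V)"
    using Cons.prems by (intro Cons.IH) (metis Suc_less_eq length_Cons o_apply)
  ultimately show ?case
    unfolding list_monomial.simps by (intro poly_carrier_mult poly_carrier_power)
qed simp

text \<open>Exponents add under multiplication, so a common bound \<open>e\<close> for the family is
  multiplied by the number of factors.\<close>

lemma lookup_list_monomial_le:
  assumes "\<And>i u j. i < length xs \<Longrightarrow> u \<in> keys (f i) \<Longrightarrow> lookup u j \<le> e"
    and "u \<in> keys (list_monomial f xs)"
  shows "lookup u j \<le> e * sum_list xs"
  using assms
proof (induction xs arbitrary: f u)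
  case (Cons x xs)
  have power: "lookup a j \<le> e * n" if "a \<in> keys (f 0 ^ n)" for a n
    using that
  proof (induction n arbitrary: a)
    case (Suc n)
    then obtain b c where "a = b + c" "b \<in> keys (f 0)" "c \<in> keys (f 0 ^ n)"
      by (auto elim: keys_multE)
    then show ?case using Suc.IH[of c] Cons.prems(1)[of 0 b j] by (simp add: lookup_add)
  qed simp
  obtain a b where ab: "u = a + b" "a \<in> keys (f 0 ^ x)" "b \<in> keys (list_monomial (f \<circ> Suc) xs)"
    using Cons.prems(2) by (auto elim: keys_multE)
  have "lookup b j \<le> e * sum_list xs"
    using Cons.prems(1) by (intro Cons.IH[OF _ ab(3)]) (metis Suc_less_eq length_Cons o_apply)
  then show ?case using power[OF ab(2)] ab(1) by (simp add: lookup_add algebra_simps)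
qed simp

text \<open>A box of exponents rather than a simplex of bounded total degree: the count is then
  exactly \<open>(N + 1) ^ m\<close>.\<close>

abbreviation bounded_lists :: "nat \<Rightarrow> nat \<Rightarrow> nat list set"
  where "bounded_lists m N \<equiv> {xs. set xs \<subseteq> {..N} \<and> length xs = m}"

text \<open>If \<open>f\<^sub>i\<close> lies in \<open>P\<^sub>i\<^sub>+\<^sub>1\<close> but not in \<open>P\<^sub>i\<close>, the \<open>f\<^sub>i\<close> are algebraically independent modulo \<open>P\<^sub>0\<close>:
  the lowest power of \<open>f\<^sub>0\<close> in a relation can be cancelled, and what remains is a relation modulo
  \<open>P\<^sub>1\<close> among the other ones.\<close>

lemma prime_chain_independent:
  fixes f :: "nat \<Rightarrow> 'n::finite mpol"
  assumes "\<And>i. i \<le> m \<Longrightarrow> primeideal (P i) (poly_ring V)"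
    and "\<And>i. i < m \<Longrightarrow> P i \<subseteq> P (Suc i)" "\<And>i. i < m \<Longrightarrow> f i \<in> P (Suc i) - P i"
    and "(\<Sum>xs\<in>bounded_lists m N. pconst (c xs) * list_monomial f xs) \<in> P 0"
  shows "\<forall>xs\<in>bounded_lists m N. c xs = 0"
  using assms
proof (induction m arbitrary: P f c)
  case 0
  interpret primeideal "P 0" "poly_ring V" using 0 by simp
  \<comment> \<open>The relation of the empty family is a constant, and a nonzero constant is a
    unit, which no prime contains.\<close>
  have "c [] = 0"
  proof (rule ccontr)
    assume c: "c [] \<noteq> 0"
    have "bounded_lists 0 N = {[]}" by auto
    then have "pconst (c []) \<in> P 0" using 0(4) by simp
    then have "pconst (1 / c []) * pconst (c []) \<in> P 0"
      using keys_pconst[of "1 / c []"] by (intro ideal_mult[OF ideal_axioms]) auto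
    then have "\<one>\<^bsub>poly_ring V\<^esub> \<in> P 0" using c by (simp flip: pconst_mult)
    then show False using one_imp_carrier I_notcarr by simp
  qed
  then show ?case by simp
next
  case (Suc m)
  interpret P0: primeideal "P 0" "poly_ring V" using Suc.prems(1) by simp
  interpret P1: primeideal "P 1" "poly_ring V" using Suc.prems(1)[of 1] by simp
  let ?C = "carrier (poly_ring V)"
  have f_carrier: "f i \<in> ?C" if "i < Suc m" for i
    using Suc.prems(3)[OF that] Suc.prems(1)[of "Suc i"] that
    by (meson DiffD1 Suc_leI ideal.Icarr primeideal.axioms(1))
  have f0: "f 0 \<in> P 1" "f 0 \<notin> P 0" using Suc.prems(3)[of 0] by auto
  \<comment> \<open>The coefficient of \<open>f 0 ^ x\<close> when the relation is arranged by
    powers of \<open>f 0\<close>.\<close>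
  define g where "g x = (\<Sum>xs\<in>bounded_lists m N. pconst (c (x # xs)) * list_monomial (f \<circ> Suc) xs)" for x
  have g_carrier: "g x \<in> ?C" for x
    unfolding g_def
    using f_carrier by (intro poly_carrier_sum poly_carrier_mult poly_carrier_const list_monomial_carrier)
      (simp only: o_def, auto)
  have lists: "bounded_lists (Suc m) N = (\<lambda>(x, xs). x # xs) ` ({..N} \<times> bounded_lists m N)"
    by (auto simp: length_Suc_conv image_iff)
  have inj: "inj_on (\<lambda>(x, xs). x # xs) ({..N} \<times> bounded_lists m N)"
    by (auto simp: inj_on_def)
  have "(\<Sum>xs\<in>bounded_lists (Suc m) N. pconst (c xs) * list_monomial f xs)
      = (\<Sum>x\<le>N. f 0 ^ x * g x)"
    unfolding lists sum.reindex[OF inj] g_def sum_distrib_left sum.cartesian_product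
    by (intro sum.cong) (auto simp: algebra_simps)
  then have rel: "(\<Sum>x\<le>N. f 0 ^ x * g x) \<in> P 0" using Suc.prems(4) by simp
  \<comment> \<open>Once the coefficients below \<open>x\<close> vanish, \<open>f 0 ^ x\<close> is
    cancelled using that \<open>f 0\<close> is outside the prime \<open>P 0\<close>. All later terms
    still contain \<open>f 0\<close>, which lies in \<open>P 1\<close>, so \<open>g x\<close> lies
    in \<open>P 1\<close> as well.\<close>
  have "x \<le> N \<Longrightarrow> \<forall>xs\<in>bounded_lists m N. c (x # xs) = 0" for x
  proof (induction x rule: less_induct)
    case (less x)
    have "g y = 0" if "y < x" for y
      using less that by (simp add: g_def)
    then have "(\<Sum>y\<le>N. f 0 ^ y * g y) = (\<Sum>y\<in>{x..N}. f 0 ^ y * g y)"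
      by (intro sum.mono_neutral_right) (auto simp: not_le)
    also have "\<dots> = (\<Sum>y\<in>{x..N}. f 0 ^ x * (f 0 ^ (y - x) * g y))"
      by (intro sum.cong) (auto simp: mult.assoc[symmetric] power_add[symmetric])
    also have "\<dots> = f 0 ^ x * (\<Sum>y\<in>{x..N}. f 0 ^ (y - x) * g y)" (is "_ = _ * ?r")
      by (simp add: sum_distrib_left)
    finally have "f 0 ^ x * ?r \<in> P 0" using rel by simp
    moreover have r: "?r \<in> ?C"
      using f_carrier by (intro poly_carrier_sum poly_carrier_mult poly_carrier_power g_carrier) blast
    moreover have "f 0 ^ n * r \<in> P 0 \<Longrightarrow> r \<in> ?C \<Longrightarrow> r \<in> P 0" for n r
    proof (induction n)
      case (Suc n)
      have "f 0 ^ n * r \<in> ?C"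
        using f_carrier Suc.prems by (intro poly_carrier_mult poly_carrier_power) blast+
      then show ?case
        using P0.I_prime[of "f 0" "f 0 ^ n * r"] f_carrier[of 0] f0(2) Suc
        by (simp add: mult.assoc)
    qed simp
    ultimately have "?r \<in> P 0" by blast
    then have r1: "?r \<in> P 1" using Suc.prems(2)[of 0] by auto
    have "?r = g x + (\<Sum>y\<in>{Suc x..N}. f 0 ^ (y - x) * g y)"
      using less.prems by (simp add: sum.atLeast_Suc_atMost)
    moreover have "f 0 ^ (y - x) * g y \<in> P 1" if "y \<in> {Suc x..N}" for y
    proof -
      have "f 0 ^ (y - x) * g y = (f 0 ^ (y - Suc x) * g y) * f 0"
        using that by (simp add: Suc_diff_le flip: Suc_diff_Suc)
      moreover have "f 0 ^ (y - Suc x) * g y \<in> ?C"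
        using f_carrier by (intro poly_carrier_mult poly_carrier_power g_carrier) blast
      ultimately show ?thesis using f0(1) ideal_mult[OF P1.ideal_axioms] by simp
    qed
    then have "(\<Sum>y\<in>{Suc x..N}. f 0 ^ (y - x) * g y) \<in> P 1"
      by (rule ideal_sum[OF P1.ideal_axioms])
    ultimately have "g x \<in> P 1"
      using ideal_diff[OF P1.ideal_axioms r1, of "\<Sum>y\<in>{Suc x..N}. f 0 ^ (y - x) * g y"] by simp
    \<comment> \<open>A relation for the shifted chain and the shifted family, to which the
      induction hypothesis on the length applies.\<close>
    then have "(\<Sum>xs\<in>bounded_lists m N. pconst (c (x # xs)) * list_monomial (f \<circ> Suc) xs) \<in> (P \<circ> Suc) 0"
      by (simp add: g_def)
    then show ?case
    proof (rule Suc.IH[rotated 3])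
      fix i
      show "i \<le> m \<Longrightarrow> primeideal ((P \<circ> Suc) i) (poly_ring V)"
        using Suc.prems(1)[of "Suc i"] by simp
      show "i < m \<Longrightarrow> (P \<circ> Suc) i \<subseteq> (P \<circ> Suc) (Suc i)"
        using Suc.prems(2)[of "Suc i"] by simp
      show "i < m \<Longrightarrow> (f \<circ> Suc) i \<in> (P \<circ> Suc) (Suc i) - (P \<circ> Suc) i"
        using Suc.prems(3)[of "Suc i"] by simp
    qed
  qed
  then show ?case unfolding lists by auto
qed

section \<open>The length of chains of prime ideals\<close>

lemma vector_space_mpol: "vector_space (\<lambda>c p. pconst c * p)"
  by unfold_locales (simp_all add: pconst_add pconst_mult algebra_simps)

text \<open>With \<tau> the set of variables outside \<open>P 0\<close>, the
  \<open>(N + 1) ^ m\<close> monomials in the \<open>f i\<close> remain linearly independent after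
  the other variables are set to zero. They then lie in the span of the monomials in \<tau> with
  exponents at most \<open>e * m * N\<close>, and comparing growth in \<open>N\<close> gives the
  bound.\<close>

lemma prime_chain_length:
  fixes V :: "'n::finite set"
  assumes prime: "\<And>i. i \<le> m \<Longrightarrow> primeideal (P i) (poly_ring V)"
    and strict: "\<And>i. i < m \<Longrightarrow> P i \<subset> P (Suc i)"
  shows "m \<le> card {j \<in> V. pvar j \<notin> P 0}"
proof -
  define \<tau> where "\<tau> = {j \<in> V. pvar j \<notin> P 0}"
  interpret P0: primeideal "P 0" "poly_ring V" using prime by simp
  have "\<forall>i<m. \<exists>p. p \<in> P (Suc i) - P i" using strict by blast
  then obtain f where f: "\<And>i. i < m \<Longrightarrow> f i \<in> P (Suc i) - P i" by metis
  have f_carrier: "f i \<in> carrier (poly_ring V)" if "i < m" for i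
    using f[OF that] prime[of "Suc i"] that
    by (meson DiffD1 Suc_leI ideal.Icarr primeideal.axioms(1))
  \<comment> \<open>Only finitely many exponents occur in the \<open>f i\<close>, so they have a
    common bound \<open>e\<close>.\<close>
  have "finite (\<Union>i<m. \<Union>u\<in>keys (f i). range (lookup u))"
    by (intro finite_UN_I) simp_all
  then obtain e where "\<forall>x\<in>(\<Union>i<m. \<Union>u\<in>keys (f i). range (lookup u)). x \<le> e"
    unfolding finite_nat_set_iff_bounded_le by (rule exE)
  then have e: "lookup u j \<le> e" if "i < m" "u \<in> keys (f i)" for i u j
    using that by blast
  let ?Z = "V - \<tau>"
  \<comment> \<open>The variables set to zero belong to \<open>P 0\<close>, so classes modulo
    \<open>P 0\<close> do not change.\<close>
  have congr: "p - kill_vars ?Z p \<in> P 0" if "p \<in> carrier (poly_ring V)" for p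
    unfolding kill_vars_def using that
    by (intro subst_congruent[OF P0.ideal_axioms]) (auto simp: \<tau>_def ideal_zero[OF P0.ideal_axioms])
  interpret vs: vector_space "\<lambda>c (p :: 'n mpol). pconst c * p" by (rule vector_space_mpol)
  have "(N + 1) ^ m \<le> (e * m * N + 1) ^ card \<tau>" for N
  proof -
    define B where "B = {u :: 'n \<Rightarrow>\<^sub>0 nat. keys u \<subseteq> \<tau> \<and> (\<forall>j. lookup u j \<le> e * m * N)}"
    let ?X = "bounded_lists m N" and ?F = "\<lambda>xs. kill_vars ?Z (list_monomial f xs)"
    have fin: "finite ?X" using finite_lists_length_eq[of "{..N}" m] by simp
    have carr: "list_monomial f xs \<in> carrier (poly_ring V)" if "xs \<in> ?X" for xs
      using that f_carrier by (intro list_monomial_carrier) (metis (mono_tags, lifting) mem_Collect_eq)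
    \<comment> \<open>A relation between the truncated monomials is a relation modulo
      \<open>P 0\<close> between the original ones, where independence is known.\<close>
    have indep: "\<forall>xs\<in>?X. c xs = 0" if "(\<Sum>xs\<in>?X. pconst (c xs) * ?F xs) = 0" for c
    proof -
      have const: "\<forall>u\<in>keys (pconst a). keys u \<subseteq> V" for a
        using poly_carrier_const[of a V] by (rule poly_ring_simps(1)[THEN iffD1])
      have "pconst (c xs) * (list_monomial f xs - ?F xs) \<in> P 0" if "xs \<in> ?X" for xs
        by (rule ideal_mult[OF P0.ideal_axioms const congr[OF carr[OF that]]])
      then have "(\<Sum>xs\<in>?X. pconst (c xs) * (list_monomial f xs - ?F xs)) \<in> P 0"
        by (rule ideal_sum[OF P0.ideal_axioms])
      then have rel: "(\<Sum>xs\<in>?X. pconst (c xs) * list_monomial f xs) \<in> P 0"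
        unfolding right_diff_distrib sum_subtractf that diff_zero .
      have sub: "P i \<subseteq> P (Suc i)" if "i < m" for i using strict[OF that] by blast
      show ?thesis by (rule prime_chain_independent[OF prime sub f rel])
    qed
    \<comment> \<open>Two equal images would give a relation with coefficients 1 and -1. Hence no
      vectors are lost when lists are replaced by their images.\<close>
    have inj: "inj_on ?F ?X"
    proof (rule inj_onI, rule ccontr)
      fix xs ys assume xy: "xs \<in> ?X" "ys \<in> ?X" "?F xs = ?F ys" "xs \<noteq> ys"
      define c :: "nat list \<Rightarrow> complex" where "c zs = (if zs = xs then 1 else if zs = ys then -1 else 0)" for zs
      have "(\<Sum>zs\<in>?X. pconst (c zs) * ?F zs) =
          (\<Sum>zs\<in>?X. (if zs = xs then ?F zs else 0) - (if zs = ys then ?F zs else 0))"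
        using xy(4) by (intro sum.cong) (auto simp: c_def pconst_uminus)
      also have "\<dots> = 0" using xy fin by (simp add: sum_subtractf)
      finally have "c xs = 0" using indep xy(1) by blast
      then show False by (simp add: c_def)
    qed
    have "vs.independent (?F ` ?X)"
    proof -
      have "\<forall>p\<in>?F ` ?X. c p = 0" if "(\<Sum>p\<in>?F ` ?X. pconst (c p) * p) = 0" for c
        using indep[of "c \<circ> ?F"] that by (simp add: sum.reindex[OF inj])
      then show ?thesis using fin by (subst vs.dependent_finite) auto
    qed
    moreover have "?F ` ?X \<subseteq> vs.span (pmon ` B)"
    proof
      fix p assume "p \<in> ?F ` ?X"
      then obtain xs where xs: "xs \<in> ?X" "p = ?F xs" by blast
      have "pmon u \<in> pmon ` B" if u: "u \<in> keys p" for u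
      proof -
        have "keys u \<inter> ?Z = {}" and u': "u \<in> keys (list_monomial f xs)"
          using u by (auto simp: xs(2) in_keys_iff lookup_kill_vars split: if_splits)
        moreover have "keys u \<subseteq> V" using carr[OF xs(1)] u' by simp
        ultimately have "keys u \<subseteq> \<tau>" by blast
        moreover have "lookup u j \<le> e * m * N" for j
        proof -
          have "lookup u j \<le> e * sum_list xs"
            using e xs(1) by (intro lookup_list_monomial_le[OF _ u']) auto
          also have "sum_list xs \<le> m * N"
          proof -
            have "set ys \<subseteq> {..N} \<Longrightarrow> sum_list ys \<le> length ys * N" for ys
              by (induction ys) auto
            then show ?thesis using xs(1) by blast
          qed
          finally show ?thesis by (simp add: mult.assoc)
        qed
        ultimately show ?thesis by (auto simp: B_def)
      qed
      then have "(\<Sum>u\<in>keys p. pconst (lookup p u) * pmon u) \<in> vs.span (pmon ` B)"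
        by (intro vs.span_sum vs.span_scale vs.span_base)
      then show "p \<in> vs.span (pmon ` B)"
        by (simp add: mpol_eq_sum flip: single_eq_pconst_pmon)
    qed
    moreover have "finite B" "card B = (e * m * N + 1) ^ card \<tau>"
      unfolding B_def by (rule card_bounded_exponents)+
    ultimately have "card (?F ` ?X) \<le> card (pmon ` B)"
      using vs.independent_span_bound by blast
    also have "\<dots> \<le> card B" using \<open>finite B\<close> by (rule card_image_le)
    finally show ?thesis
      using \<open>card B = _\<close> card_lists_length_eq[of "{..N}" m] by (simp add: card_image[OF inj])
  qed
  then have "m \<le> card \<tau>" by (rule power_growth)
  then show ?thesis by (simp add: \<tau>_def)
qed

section \<open>Prime ideals of quotient rings and kernels of truncations\<close>

lemma (in cring) quotient_class_mem_iff:
  assumes I: "ideal I R" and K: "ideal K R" "I \<subseteq> K" and x: "x \<in> carrier R"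
  shows "I +> x \<in> (+>) I ` K \<longleftrightarrow> x \<in> K"
proof
  interpret I: ideal I R by (rule I)
  interpret K: ideal K R by (rule K(1))
  assume "I +> x \<in> (+>) I ` K"
  then obtain k where k: "k \<in> K" "I +> x = I +> k" by blast
  then have "x \<in> I +> k" using I.a_rcos_self[OF x] by simp
  then obtain i where "i \<in> I" "x = i \<oplus> k" by (auto simp: a_r_coset_def')
  then show "x \<in> K" using k(1) K(2) K.a_closed by blast
qed blast

text \<open>One direction of the correspondence between primes containing \<open>I\<close> and
  primes of the quotient; as \<open>I\<close> lies in \<open>K\<close>, membership in the image can
  be tested on any representative.\<close>

lemma (in cring) primeideal_quotient:
  assumes I: "ideal I R" and K: "primeideal K R" "I \<subseteq> K"
  shows "primeideal ((+>) I ` K) (R Quot I)"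
proof -
  interpret I: ideal I R by (rule I)
  interpret K: primeideal K R by (rule K(1))
  note mem = quotient_class_mem_iff[OF I K.ideal_axioms K(2)]
  show ?thesis
  proof (rule primeidealI)
    show "ideal ((+>) I ` K) (R Quot I)" by (rule ring_ideal_imp_quot_ideal[OF I K.ideal_axioms])
    show "cring (R Quot I)" by (rule I.quotient_is_cring[OF is_cring])
    have "\<one> \<notin> K" using K.one_imp_carrier K.I_notcarr by blast
    then have "I +> \<one> \<notin> (+>) I ` K" by (simp add: mem)
    then show "carrier (R Quot I) \<noteq> (+>) I ` K" by (auto simp: FactRing_simps)
  next
    fix X Y assume XY: "X \<in> carrier (R Quot I)" "Y \<in> carrier (R Quot I)"
      and XYK: "X \<otimes>\<^bsub>R Quot I\<^esub> Y \<in> (+>) I ` K"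
    obtain x y where xy: "x \<in> carrier R" "y \<in> carrier R" "X = I +> x" "Y = I +> y"
      using XY by (meson FactRing_carrierE)
    have "X \<otimes>\<^bsub>R Quot I\<^esub> Y = I +> (x \<otimes> y)"
      using ring_hom_mult[OF I.rcos_ring_hom] xy by simp
    then have "x \<otimes> y \<in> K" using XYK xy by (simp add: mem)
    then show "X \<in> (+>) I ` K \<or> Y \<in> (+>) I ` K" using K.I_prime xy by blast
  qed
qed

text \<open>The kernel of a homomorphism into an integral domain that preserves 1.\<close>

lemma primeideal_kill_vars:
  fixes V :: "'n::finite set"
  shows "primeideal {p \<in> carrier (poly_ring V). kill_vars Z p = 0} (poly_ring V)" (is "primeideal ?K ?P")
proof (rule primeidealI)
  interpret cring ?P by (rule cring_poly_ring)
  show "ideal ?K ?P"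
  proof (rule ideal_poly_ringI)
    fix p q assume "p \<in> ?K" "q \<in> ?K"
    then show "p + q \<in> ?K"
      using poly_carrier_add[of p V q] by (simp add: kill_vars_def subst_add)
  next
    fix p q :: "'n mpol" assume "\<forall>u\<in>keys p. keys u \<subseteq> V" "q \<in> ?K"
    then show "p * q \<in> ?K"
      using poly_carrier_mult[of p V q] by (simp add: kill_vars_def subst_mult)
  qed (auto simp: kill_vars_def subst_zero)
  have "(1 :: 'n mpol) \<notin> ?K" by (simp add: kill_vars_def subst_one)
  moreover have "1 \<in> carrier ?P" by simp
  ultimately show "carrier ?P \<noteq> ?K" by blast
  fix a b assume "a \<in> carrier ?P" "b \<in> carrier ?P" "a \<otimes>\<^bsub>?P\<^esub> b \<in> ?K"
  then show "a \<in> ?K \<or> b \<in> ?K"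
    using mpol_mult_eq_0[of "kill_vars Z a" "kill_vars Z b"] by (auto simp: kill_vars_def subst_mult)
qed (rule cring_poly_ring)

section \<open>Prime chains in Stanley-Reisner rings\<close>

lemma sr_generators_carrier:
  "s \<in> {(\<Prod>i\<in>\<tau>. pvar i) | \<tau>. \<tau> \<subseteq> V \<and> \<tau> \<notin> \<Delta>} \<Longrightarrow> s \<in> carrier (poly_ring V)"
  by (auto intro!: poly_carrier_prod poly_carrier_pvar simp del: poly_ring_simps(1))

lemma ideal_sr_ideal: "ideal (sr_ideal V \<Delta>) (poly_ring V)"
  unfolding sr_ideal_def using sr_generators_carrier[of _ V \<Delta>]
  by (intro ring.genideal_ideal[OF ring_poly_ring] subsetI)

lemma sr_ideal_nonface: "\<tau> \<subseteq> V \<Longrightarrow> \<tau> \<notin> \<Delta> \<Longrightarrow> (\<Prod>i\<in>\<tau>. pvar i) \<in> sr_ideal V \<Delta>"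
  unfolding sr_ideal_def
  using ring.genideal_self[OF ring_poly_ring, of "{(\<Prod>i\<in>\<tau>. pvar i) | \<tau>. \<tau> \<subseteq> V \<and> \<tau> \<notin> \<Delta>}" V]
    sr_generators_carrier[of _ V \<Delta>] by blast

lemma sr_ideal_subset:
  assumes "ideal K (poly_ring V)" "\<And>\<tau>. \<tau> \<subseteq> V \<Longrightarrow> \<tau> \<notin> \<Delta> \<Longrightarrow> (\<Prod>i\<in>\<tau>. pvar i) \<in> K"
  shows "sr_ideal V \<Delta> \<subseteq> K"
  unfolding sr_ideal_def using assms by (intro Idl_subsetI) auto

text \<open>The chain pulls back to the polynomial ring, where its length is bounded by the number
  of variables outside the smallest prime. These variables form a face: otherwise their product
  would lie in that prime, and so would one of the factors.\<close>

lemma sr_ring_prime_chain_le: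
  fixes V :: "'n::finite set"
  assumes prime: "\<And>i. i \<le> m \<Longrightarrow> primeideal (P i) (sr_ring V \<Delta>)"
    and strict: "\<And>i. i < m \<Longrightarrow> P i \<subset> P (Suc i)"
  shows "\<exists>\<tau>\<in>\<Delta>. m \<le> card \<tau>"
proof -
  interpret I: ideal "sr_ideal V \<Delta>" "poly_ring V" by (rule ideal_sr_ideal)
  interpret c: ring_hom_ring "poly_ring V" "sr_ring V \<Delta>" "(+>\<^bsub>poly_ring V\<^esub>) (sr_ideal V \<Delta>)"
    unfolding sr_ring_def by (rule I.rcos_ring_hom_ring)
  define P' where "P' i = {p \<in> carrier (poly_ring V). sr_ideal V \<Delta> +>\<^bsub>poly_ring V\<^esub> p \<in> P i}" for i
  have prime': "primeideal (P' i) (poly_ring V)" if "i \<le> m" for i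
    unfolding P'_def by (rule c.primeideal_vimage[OF cring_poly_ring prime[OF that]])
  have strict': "P' i \<subset> P' (Suc i)" if i: "i < m" for i
  proof -
    obtain X where X: "X \<in> P (Suc i)" "X \<notin> P i" using strict[OF i] by blast
    have "X \<in> carrier (sr_ring V \<Delta>)"
      using prime[of "Suc i"] i X(1) by (meson Suc_leI ideal.Icarr primeideal.axioms(1))
    then obtain p where "p \<in> carrier (poly_ring V)" "X = sr_ideal V \<Delta> +>\<^bsub>poly_ring V\<^esub> p"
      unfolding sr_ring_def by (rule FactRing_carrierE)
    then have "p \<in> P' (Suc i)" "p \<notin> P' i"
      using X by (auto simp: P'_def simp del: poly_ring_simps(1))
    moreover have "P' i \<subseteq> P' (Suc i)" using strict[OF i] by (auto simp: P'_def)
    ultimately show ?thesis by blast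
  qed
  define \<tau> where "\<tau> = {j \<in> V. pvar j \<notin> P' 0}"
  have "m \<le> card \<tau>"
    unfolding \<tau>_def using prime' strict' by (rule prime_chain_length[of m P' V])
  moreover have "\<tau> \<in> \<Delta>"
  proof (rule ccontr)
    assume "\<tau> \<notin> \<Delta>"
    then have mem: "(\<Prod>i\<in>\<tau>. pvar i) \<in> sr_ideal V \<Delta>"
      by (intro sr_ideal_nonface) (auto simp: \<tau>_def)
    \<comment> \<open>The ideal itself, as a coset, is the zero element of the quotient
      ring.\<close>
    have "sr_ideal V \<Delta> \<in> P 0"
      using additive_subgroup.zero_closed[of "P 0" "sr_ring V \<Delta>"] prime[of 0]
      by (simp add: primeideal_def ideal_def sr_ring_def FactRing_def)
    then have "(\<Prod>i\<in>\<tau>. pvar i) \<in> P' 0"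
      unfolding P'_def using I.a_rcos_const[OF mem] I.Icarr[OF mem] by simp
    then show False
      using primeideal_prod_pvar[OF prime'[of 0], of \<tau>] by (auto simp: \<tau>_def)
  qed
  ultimately show ?thesis by blast
qed

text \<open>The chain arises by first setting the variables outside \<tau> to zero and then those of
  \<tau> one after another. Every kernel contains the Stanley-Reisner ideal, since a nonface has a
  vertex outside \<tau>.\<close>

lemma sr_ring_prime_chain_exists:
  fixes V :: "'n::finite set"
  assumes \<tau>: "\<tau> \<in> \<Delta>" and down: "\<And>\<rho> \<sigma>. \<sigma> \<in> \<Delta> \<Longrightarrow> \<rho> \<subseteq> \<sigma> \<Longrightarrow> \<rho> \<in> \<Delta>" and V: "\<tau> \<subseteq> V"
  shows "\<exists>P. (\<forall>i\<le>card \<tau>. primeideal (P i) (sr_ring V \<Delta>)) \<and> (\<forall>i<card \<tau>. P i \<subset> P (Suc i))"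
proof -
  interpret cring "poly_ring V" by (rule cring_poly_ring)
  obtain e where e: "bij_betw e {0..<card \<tau>} \<tau>"
    using ex_bij_betw_nat_finite[of \<tau>] by auto
  define Z where "Z i = (V - \<tau>) \<union> e ` {0..<i}" for i
  define K where "K i = {p \<in> carrier (poly_ring V). kill_vars (Z i) p = 0}" for i
  have prime: "primeideal (K i) (poly_ring V)" for i
    unfolding K_def by (rule primeideal_kill_vars)
  have ideal: "ideal (K i) (poly_ring V)" for i
    using prime primeideal.axioms(1) by blast
  have sub: "sr_ideal V \<Delta> \<subseteq> K i" for i
  proof (rule sr_ideal_subset[OF ideal])
    fix \<rho> assume \<rho>: "\<rho> \<subseteq> V" "\<rho> \<notin> \<Delta>"
    then obtain j where j: "j \<in> \<rho>" "j \<notin> \<tau>" using down[OF \<tau>] by blast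
    then have "kill_vars (Z i) (\<Prod>i\<in>\<rho>. pvar i) = 0"
      using \<rho> by (auto simp: kill_vars_def subst_prod subst_pvar Z_def intro!: prod_zero bexI[of _ j])
    moreover have "(\<Prod>i\<in>\<rho>. pvar i) \<in> carrier (poly_ring V)"
      using \<rho> by (intro poly_carrier_prod poly_carrier_pvar) auto
    ultimately show "(\<Prod>i\<in>\<rho>. pvar i) \<in> K i" by (simp add: K_def)
  qed
  define P where "P i = (+>\<^bsub>poly_ring V\<^esub>) (sr_ideal V \<Delta>) ` K i" for i
  have "primeideal (P i) (sr_ring V \<Delta>)" for i
    unfolding P_def sr_ring_def by (rule primeideal_quotient[OF ideal_sr_ideal prime sub])
  moreover have "P i \<subset> P (Suc i)" if i: "i < card \<tau>" for i
  proof
    have "Z i \<subseteq> Z (Suc i)" by (auto simp: Z_def)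
    then have "kill_vars (Z (Suc i)) p = 0" if "kill_vars (Z i) p = 0" for p
    proof (intro poly_mapping_eqI)
      fix u
      have "lookup (kill_vars (Z i) p) u = 0" using that by simp
      then show "lookup (kill_vars (Z (Suc i)) p) u = lookup 0 u"
        using \<open>Z i \<subseteq> Z (Suc i)\<close> by (auto simp: lookup_kill_vars split: if_splits)
    qed
    then show "P i \<subseteq> P (Suc i)" by (auto simp: P_def K_def)
    \<comment> \<open>The variable \<open>e i\<close> witnesses strictness: it is set to zero at
      stage \<open>Suc i\<close> but not at stage \<open>i\<close>.\<close>
    have ei: "e i \<in> \<tau>" using e i by (auto dest: bij_betwE)
    have "e i \<notin> e ` {0..<i}"
      using bij_betw_imp_inj_on[OF e] i by (auto dest: inj_onD)
    then have "e i \<notin> Z i" "e i \<in> Z (Suc i)" using ei by (auto simp: Z_def)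
    moreover have "pvar (e i) \<noteq> (0 :: 'n mpol)"
      by (metis keys_pvar keys_zero insert_not_empty)
    ultimately have mem: "pvar (e i) \<in> K (Suc i)" "pvar (e i) \<notin> K i"
      using ei V by (auto simp: K_def kill_vars_def subst_pvar)
    have carr: "pvar (e i) \<in> carrier (poly_ring V)" using ei V by auto
    have "sr_ideal V \<Delta> +>\<^bsub>poly_ring V\<^esub> pvar (e i) \<in> P (Suc i)"
      unfolding P_def using mem(1) by (rule imageI)
    moreover have "sr_ideal V \<Delta> +>\<^bsub>poly_ring V\<^esub> pvar (e i) \<notin> P i"
      unfolding P_def quotient_class_mem_iff[OF ideal_sr_ideal ideal sub carr] by (rule mem(2))
    ultimately show "P i \<noteq> P (Suc i)" by metis
  qed
  ultimately show ?thesis by blast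
qed

text \<open>Every face yields a chain as long as its cardinality, and every chain is bounded by some
  face. For the void complex both suprema are over empty sets, so both sides are minus
  infinity.\<close>

lemma krull_dim_sr_ring:
  fixes V :: "'n::finite set"
  assumes down: "\<And>\<rho> \<sigma>. \<sigma> \<in> \<Delta> \<Longrightarrow> \<rho> \<subseteq> \<sigma> \<Longrightarrow> \<rho> \<in> \<Delta>" and V: "\<And>\<tau>. \<tau> \<in> \<Delta> \<Longrightarrow> \<tau> \<subseteq> V"
  shows "krull_dim (sr_ring V \<Delta>) = complex_dim \<Delta> + 1"
proof (rule antisym)
  have *: "ereal (real (card \<tau>)) \<le> complex_dim \<Delta> + 1" if "\<tau> \<in> \<Delta>" for \<tau>
  proof -
    have "ereal (real (card \<tau>) - 1) \<le> complex_dim \<Delta>"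
      unfolding complex_dim_def using that by (rule SUP_upper)
    then have "ereal (real (card \<tau>) - 1) + 1 \<le> complex_dim \<Delta> + 1"
      by (rule add_right_mono)
    then show ?thesis by (simp add: one_ereal_def)
  qed
  show "krull_dim (sr_ring V \<Delta>) \<le> complex_dim \<Delta> + 1"
    unfolding krull_dim_def
  proof (rule Sup_least, clarify)
    fix m P assume "\<forall>i\<le>m. primeideal (P i) (sr_ring V \<Delta>)" "\<forall>i<m. P i \<subset> P (Suc i)"
    then obtain \<tau> where "\<tau> \<in> \<Delta>" "m \<le> card \<tau>"
      using sr_ring_prime_chain_le[of m P V \<Delta>] by blast
    then show "ereal (real m) \<le> complex_dim \<Delta> + 1"
      using *[of \<tau>] order_trans[of "ereal (real m)" "ereal (real (card \<tau>))"] by simp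
  qed
  have "complex_dim \<Delta> \<le> krull_dim (sr_ring V \<Delta>) - 1"
    unfolding complex_dim_def
  proof (rule SUP_least)
    fix \<tau> assume "\<tau> \<in> \<Delta>"
    then have "ereal (real (card \<tau>)) \<le> krull_dim (sr_ring V \<Delta>)"
      unfolding krull_dim_def
      using sr_ring_prime_chain_exists[OF _ down V, of \<tau>] by (intro Sup_upper) auto
    then have "ereal (real (card \<tau>)) - 1 \<le> krull_dim (sr_ring V \<Delta>) - 1"
      by (intro ereal_minus_mono) auto
    then show "ereal (real (card \<tau>) - 1) \<le> krull_dim (sr_ring V \<Delta>) - 1"
      by (simp add: one_ereal_def)
  qed
  then show "complex_dim \<Delta> + 1 \<le> krull_dim (sr_ring V \<Delta>)"
    by (subst (asm) ereal_le_minus) auto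
qed

section \<open>The link at a fake exponent\<close>

text \<open>If \<open>\<sigma>\<close> had more than \<open>d\<close> elements, two exponents supported on \<open>\<sigma>\<close> would have the same image
  under \<open>A\<close>, and the initial form of their binomial would put a monomial supported on \<open>\<sigma>\<close> into
  the initial ideal.\<close>

lemma card_standard_pair_le:
  fixes A :: "int^'n::finite^'d::finite"
  assumes generic: "generic_weight A w"
    and pair: "(a, \<sigma>) \<in> standard_pairs (initial_ideal w (toric_ideal A))"
  shows "card \<sigma> \<le> CARD('d)"
proof -
  \<comment> \<open>A bound for all absolute row sums of \<open>A\<close>: exponents up to
    \<open>N\<close> are mapped into a box with \<open>2 * C * N + 1\<close> values per
    coordinate.\<close>
  define C where "C = nat (\<Sum>i\<in>UNIV. \<Sum>j\<in>UNIV. \<bar>A $ i $ j\<bar>)"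
  have C: "(\<Sum>j\<in>UNIV. \<bar>A $ i $ j\<bar>) \<le> int C" for i
  proof -
    have "(\<Sum>j\<in>UNIV. \<bar>A $ i $ j\<bar>) \<le> (\<Sum>i\<in>UNIV. \<Sum>j\<in>UNIV. \<bar>A $ i $ j\<bar>)"
      by (intro member_le_sum) (auto intro: sum_nonneg)
    then show ?thesis by (simp add: C_def)
  qed
  have "(N + 1) ^ card \<sigma> \<le> (2 * C * N + 1) ^ CARD('d)" for N
  proof -
    define B where "B = {u :: 'n \<Rightarrow>\<^sub>0 nat. keys u \<subseteq> \<sigma> \<and> (\<forall>j. lookup u j \<le> N)}"
    let ?Y = "(UNIV :: 'd set) \<rightarrow>\<^sub>E {- int (C * N)..int (C * N)}"
    have "inj_on (\<lambda>u. ($) (mat_exp A u)) B"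
    proof (rule inj_onI, rule ccontr)
      fix u u' assume u: "u \<in> B" "u' \<in> B" "($) (mat_exp A u) = ($) (mat_exp A u')" "u \<noteq> u'"
      \<comment> \<open>Multiplying by \<open>pmon a\<close> would produce a monomial that the
        second condition on the standard pair excludes.\<close>
      have not_in: "pmon s \<notin> initial_ideal w (toric_ideal A)" if "s \<in> B" for s
      proof
        assume "pmon s \<in> initial_ideal w (toric_ideal A)"
        then have "pmon a * pmon s \<in> initial_ideal w (toric_ideal A)"
          by (intro ideal_mult[OF ideal_initial_ideal]) simp_all
        then show False
          using pair that by (auto simp: standard_pairs_def B_def pmon_add)
      qed
      have "mat_exp A u = mat_exp A u'" using u(3) by (simp add: vec_nth_inject)
      then show False
        using generic_weight_binomial[OF generic _ u(4)] not_in[OF u(1)] not_in[OF u(2)] by blast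
    qed
    moreover have "(\<lambda>u. ($) (mat_exp A u)) ` B \<subseteq> ?Y"
    proof (intro image_subsetI PiE_I)
      fix u i assume u: "u \<in> B"
      have "\<bar>mat_exp A u $ i\<bar> \<le> (\<Sum>j\<in>UNIV. \<bar>A $ i $ j * int (lookup u j)\<bar>)"
        by (simp add: mat_exp_def)
      also have "\<dots> \<le> (\<Sum>j\<in>UNIV. \<bar>A $ i $ j\<bar> * int N)"
        using u by (intro sum_mono) (auto simp: abs_mult B_def intro: mult_left_mono)
      also have "\<dots> \<le> int (C * N)"
        using mult_right_mono[OF C[of i], of "int N"] by (simp add: sum_distrib_right)
      finally show "mat_exp A u $ i \<in> {- int (C * N)..int (C * N)}" by auto
    qed auto
    moreover have "finite ?Y" by (simp add: finite_PiE)
    ultimately have "card B \<le> card ?Y" by (rule card_inj_on_le)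
    moreover have "card ?Y = (2 * C * N + 1) ^ CARD('d)"
      by (simp add: card_PiE nat_add_distrib nat_mult_distrib algebra_simps)
    moreover have "card B = (N + 1) ^ card \<sigma>"
      unfolding B_def by (rule card_bounded_exponents)
    ultimately show ?thesis by simp
  qed
  then show ?thesis by (rule power_growth)
qed

section \<open>The dimension of the link\<close>

lemma link_down_closed: "\<sigma> \<in> link A w v \<Longrightarrow> \<rho> \<subseteq> \<sigma> \<Longrightarrow> \<rho> \<in> link A w v"
  unfolding link_iff Delta_def by fastforce

text \<open>A face together with the disjoint set \<open>nsupp v\<close> lies in the free set of a
  standard pair, which has at most d elements. A top-dimensional pair attains the bound through the
  face \<open>\<sigma> - nsupp v\<close>.\<close>

lemma link_complex_dim:
  fixes A :: "int^'n::finite^'d::finite"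
  assumes generic: "generic_weight A w"
    and top: "(a, \<sigma>) \<in> std_pairs_at A w v" "card \<sigma> = CARD('d)"
  shows "complex_dim (link A w v) = ereal (real CARD('d) - real (card (nsupp v)) - 1)"
proof (rule antisym)
  show "complex_dim (link A w v) \<le> ereal (real CARD('d) - real (card (nsupp v)) - 1)"
    unfolding complex_dim_def
  proof (rule SUP_least)
    fix \<tau> assume "\<tau> \<in> link A w v"
    then obtain a' \<sigma>' where \<sigma>': "(a', \<sigma>') \<in> std_pairs_at A w v" "\<tau> \<union> nsupp v \<subseteq> \<sigma>'"
        and disj: "\<tau> \<inter> nsupp v = {}"
      by (auto simp: link_iff Delta_def)
    have "card \<tau> + card (nsupp v) = card (\<tau> \<union> nsupp v)"
      using disj by (simp add: card_Un_disjoint)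
    also have "\<dots> \<le> card \<sigma>'" using \<sigma>'(2) by (intro card_mono) auto
    also have "\<dots> \<le> CARD('d)"
      using \<sigma>'(1) by (intro card_standard_pair_le[OF generic]) (auto simp: std_pairs_at_def)
    finally show "ereal (real (card \<tau>) - 1) \<le> ereal (real CARD('d) - real (card (nsupp v)) - 1)"
      by simp
  qed
  \<comment> \<open>A pair at \<open>v\<close> fixes only coordinates where \<open>v\<close> is a
    natural number, so negative ones are free.\<close>
  have sub: "nsupp v \<subseteq> \<sigma>"
    using top(1) nsupp_subset[of v] by (fastforce simp: std_pairs_at_def nat_coords_def)
  then have "(\<sigma> - nsupp v) \<union> nsupp v = \<sigma>" by blast
  then have "\<sigma> - nsupp v \<in> link A w v"
    using top(1) by (auto simp: link_iff Delta_def)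
  then have "ereal (real (card (\<sigma> - nsupp v)) - 1) \<le> complex_dim (link A w v)"
    unfolding complex_dim_def by (rule SUP_upper)
  moreover have "real (card (\<sigma> - nsupp v)) = real CARD('d) - real (card (nsupp v))"
    using sub card_mono[OF _ sub] top(2) by (simp add: card_Diff_subset of_nat_diff)
  ultimately show "ereal (real CARD('d) - real (card (nsupp v)) - 1) \<le> complex_dim (link A w v)"
    by simp
qed

section \<open>The isomorphism of graded quotients and its dimension formula\<close>

theorem proposition4p4:
  fixes A :: "int^'n::finite^'d::finite" and \<beta> :: "complex^'d" and w :: "real^'n"
    and v :: "complex^'n" and m :: nat and gp gm :: "nat \<Rightarrow> 'n \<Rightarrow>\<^sub>0 nat"
    and L :: "'n \<Rightarrow> 'n mpol" and l :: "nat \<Rightarrow> 'n mpol"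
  assumes rank: "rank (map_matrix of_int A :: rat^'n^'d) = CARD('d)"
    and hyperplane: "\<exists>(h::rat^'d) c. h \<noteq> 0 \<and> c \<noteq> 0 \<and>
          (\<forall>j. (\<Sum>i\<in>UNIV. h $ i * of_int (A $ i $ j)) = c)"
    and generic: "generic_weight A w"
    and fake: "fake_exponent A \<beta> w v"
    and groebner: "reduced_groebner_basis w (toric_ideal A)
          ((\<lambda>i. pmon (gp i) - pmon (gm i)) ` {1..m})"
    and leading: "\<forall>i\<in>{1..m}. pmon (gp i) \<in> initial_ideal w (toric_ideal A)"
    and L_form: "\<forall>i\<in>nsupp v. linear_form_in (- nsupp v) (L i)"
    and l_form: "\<forall>q\<in>{1..CARD('d) - card (nsupp v)}. linear_form_in (- nsupp v) (l q)"
    and generators: "lin_ideal A = Idl\<^bsub>poly_ring UNIV\<^esub>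
          ((\<lambda>i. pvar i - L i) ` nsupp v \<union> l ` {1..CARD('d) - card (nsupp v)})"
  shows "let V = - nsupp v; \<Delta> = link A w v;
             T = poly_ring UNIV; Q = Q_ideal A v m gp gm;
             R = sr_ring V \<Delta>;
             J = Idl\<^bsub>R\<^esub> (sr_class V \<Delta> ` l ` {1..CARD('d) - card (nsupp v)})
         in (\<forall>q\<in>{1..CARD('d) - card (nsupp v)}. sr_class V \<Delta> (l q) \<in> carrier R) \<and>
            (\<exists>\<phi> \<in> ring_iso (T Quot Q) (R Quot J).
               (\<forall>c. \<phi> (Q +>\<^bsub>T\<^esub> pconst c) = J +>\<^bsub>R\<^esub> sr_class V \<Delta> (pconst c)) \<and>
               (\<forall>k. \<phi> ` (\<lambda>p. Q +>\<^bsub>T\<^esub> p) ` homog_part UNIV k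
                    = (\<lambda>p. J +>\<^bsub>R\<^esub> sr_class V \<Delta> p) ` homog_part V k)) \<and>
            ((\<exists>(a, \<sigma>) \<in> std_pairs_at A w v. card \<sigma> = CARD('d)) \<longrightarrow>
               ereal (real CARD('d) - real (card (nsupp v))) = krull_dim R \<and>
               krull_dim R = complex_dim \<Delta> + 1)"
proof -
  define V where "V = - nsupp v"
  define \<Delta> where "\<Delta> = link A w v"
  define T :: "'n mpol ring" where "T = poly_ring UNIV"
  define Q where "Q = Q_ideal A v m gp gm"
  define R where "R = sr_ring V \<Delta>"
  define S where "S = l ` {1..CARD('d) - card (nsupp v)}"
  define J where "J = Idl\<^bsub>R\<^esub> (sr_class V \<Delta> ` S)"
  \<comment> \<open>The elimination: variables indexed by \<open>nsupp v\<close> become their linear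
    forms, the others stay.\<close>
  define h where "h j = (if j \<in> nsupp v then L j else pvar j)" for j
  define M where "M = M_theta v m gp gm"
  let ?I = "sr_ideal V \<Delta>" and ?G = "\<lambda>i. G_set v (gp i) (gm i)"
  interpret T: cring T unfolding T_def by (rule cring_poly_ring)
  have face_iff: "\<tau> \<in> \<Delta> \<longleftrightarrow> \<not> (\<exists>i\<in>{1..m}. ?G i \<subseteq> \<tau>)" if "\<tau> \<subseteq> V" for \<tau>
    unfolding \<Delta>_def using that by (intro link_iff_G_set[OF groebner]) (auto simp: V_def)
  have G_sub: "?G i \<subseteq> V" for i
    by (auto simp: V_def G_set_def nsupp_shift_def nsupp_def)
  have h_homog: "h j \<in> homog_part V 1" for j
    using L_form linear_form_in_homog_part[of V "L j"] homog_part_pvar[of j V] by (auto simp: h_def V_def)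
  have S_homog: "S \<subseteq> homog_part V 1"
    using l_form linear_form_in_homog_part unfolding S_def V_def by blast
  have homog_carrier: "homog_part V k \<subseteq> carrier (poly_ring V)" for k
    by (auto simp: homog_part_def)
  have lin: "ideal (lin_ideal A) T"
    unfolding lin_ideal_def T_def by (rule ideal_Idl) simp
  have M: "ideal M T"
    unfolding M_def M_theta_def T_def by (rule ideal_Idl) simp
  \<comment> \<open>Writing the sum as a generated ideal provides the minimality that the
    elimination requires.\<close>
  have Q_eq: "Q = Idl\<^bsub>T\<^esub> (lin_ideal A \<union> M)"
    unfolding T.union_genideal[OF lin M] by (simp add: Q_def Q_ideal_def T_def M_def)
  have Q_T: "ideal Q T"
    unfolding Q_def Q_ideal_def T_def[symmetric] M_def[symmetric] by (rule T.add_ideals[OF lin M])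
  then have Q: "ideal Q (poly_ring UNIV)" by (simp only: T_def)
  have "lin_ideal A \<union> M \<subseteq> Q"
    unfolding Q_eq by (rule T.genideal_self) (auto simp: T_def)
  then have lin_Q: "lin_ideal A \<subseteq> Q" and M_Q: "M \<subseteq> Q" by auto
  have gen_lin: "s \<in> lin_ideal A" if "s \<in> (\<lambda>i. pvar i - L i) ` nsupp v \<union> S" for s
    unfolding generators using that by (intro Idl_self) (simp_all add: S_def)
  have "\<exists>\<phi>\<in>ring_iso (poly_ring UNIV Quot Q) (poly_ring V Quot ?I Quot
          (Idl\<^bsub>poly_ring V Quot ?I\<^esub> ((+>\<^bsub>poly_ring V\<^esub>) ?I ` S))).
      \<forall>p. \<phi> (Q +>\<^bsub>poly_ring UNIV\<^esub> p) =
        (Idl\<^bsub>poly_ring V Quot ?I\<^esub> ((+>\<^bsub>poly_ring V\<^esub>) ?I ` S))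
          +>\<^bsub>poly_ring V Quot ?I\<^esub> (?I +>\<^bsub>poly_ring V\<^esub> subst h p)"
  proof (rule quotient_by_elimination)
    show "h j \<in> carrier (poly_ring V)" for j using h_homog homog_carrier by blast
    show "h j = pvar j" if "j \<in> V" for j using that by (simp add: h_def V_def)
    show "ideal ?I (poly_ring V)" by (rule ideal_sr_ideal)
    show "S \<subseteq> carrier (poly_ring V)" using S_homog homog_carrier by blast
    show "ideal Q (poly_ring UNIV)" by (rule Q)
    show "pvar j - h j \<in> Q" for j
      using gen_lin[of "pvar j - L j"] lin_Q ideal_zero[OF Q] by (auto simp: h_def)
    show "S \<subseteq> Q" using gen_lin lin_Q by blast
    \<comment> \<open>A nonface contains some \<open>?G i\<close>, so its monomial is a multiple of
      a generator of \<open>M\<close>.\<close>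
    have "?I \<subseteq> Q \<inter> carrier (poly_ring V)"
    proof (rule sr_ideal_subset[OF ideal_restrict[OF Q]])
      fix \<tau> assume \<tau>: "\<tau> \<subseteq> V" "\<tau> \<notin> \<Delta>"
      then obtain i where i: "i \<in> {1..m}" "?G i \<subseteq> \<tau>" using face_iff by blast
      have "(\<Prod>j\<in>?G i. pvar j) \<in> M"
        unfolding M_def M_theta_def using i(1) by (intro Idl_self) auto
      then have "(\<Prod>j\<in>\<tau> - ?G i. pvar j) * (\<Prod>j\<in>?G i. pvar j) \<in> Q"
        using M_Q by (intro ideal_mult[OF Q]) auto
      then have "(\<Prod>j\<in>\<tau>. pvar j) \<in> Q" using prod.subset_diff[OF i(2)] by (metis finite)
      moreover have "(\<Prod>j\<in>\<tau>. pvar j) \<in> carrier (poly_ring V)"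
        using \<tau>(1) by (intro poly_carrier_prod poly_carrier_pvar) auto
      ultimately show "(\<Prod>j\<in>\<tau>. pvar j) \<in> Q \<inter> carrier (poly_ring V)" by (rule IntI)
    qed
    then show "?I \<subseteq> Q" by (rule order_trans) (rule Int_lower1)
  next
    fix K assume K: "ideal K (poly_ring UNIV)" "\<forall>j. pvar j - h j \<in> K" "?I \<subseteq> K" "S \<subseteq> K"
    have "pvar j - L j \<in> K" if "j \<in> nsupp v" for j
      using K(2)[rule_format, of j] that by (simp add: h_def)
    then have "lin_ideal A \<subseteq> K"
      unfolding generators S_def[symmetric] using K(4) by (intro Idl_subsetI[OF K(1)]) auto
    \<comment> \<open>Each \<open>?G i\<close> is itself a nonface, so the generators of
      \<open>M\<close> already lie in the Stanley-Reisner ideal.\<close>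
    moreover have "M \<subseteq> K"
    proof -
      have "(\<Prod>j\<in>?G i. pvar j) \<in> K" if "i \<in> {1..m}" for i
      proof -
        have "?G i \<notin> \<Delta>" using face_iff[OF G_sub] that by blast
        then show ?thesis using sr_ideal_nonface[OF G_sub] K(3) by blast
      qed
      then show ?thesis unfolding M_def M_theta_def by (intro Idl_subsetI[OF K(1)]) auto
    qed
    ultimately have "lin_ideal A \<union> M \<subseteq> K" by (rule Un_least)
    then show "Q \<subseteq> K"
      unfolding Q_eq using K(1) by (intro T.genideal_minimal) (simp_all only: T_def)
  qed
  moreover have sr_class_eq: "sr_class V \<Delta> = (+>\<^bsub>poly_ring V\<^esub>) ?I"
    by (intro ext) (simp only: sr_class_def)
  ultimately have "\<exists>\<phi>\<in>ring_iso (T Quot Q) (R Quot J).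
      \<forall>p. \<phi> (Q +>\<^bsub>T\<^esub> p) = J +>\<^bsub>R\<^esub> sr_class V \<Delta> (subst h p)"
    unfolding J_def R_def sr_ring_def T_def by (simp only:)
  then obtain \<phi> where \<phi>: "\<phi> \<in> ring_iso (T Quot Q) (R Quot J)"
    and \<phi>_class: "\<phi> (Q +>\<^bsub>T\<^esub> p) = J +>\<^bsub>R\<^esub> sr_class V \<Delta> (subst h p)" for p
    by (elim bexE) (rule that, assumption, erule spec)
  \<comment> \<open>Compatibility with constants makes the ring isomorphism complex-linear.\<close>
  have constants: "\<phi> (Q +>\<^bsub>T\<^esub> pconst c) = J +>\<^bsub>R\<^esub> sr_class V \<Delta> (pconst c)" for c
    unfolding \<phi>_class subst_const by (rule refl)
  \<comment> \<open>The substitution preserves degrees and fixes polynomials in the variables of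
    \<open>V\<close>, so it maps each homogeneous part onto its counterpart.\<close>
  have subst_image: "subst h ` homog_part UNIV k = homog_part V k" for k
  proof
    show "subst h ` homog_part UNIV k \<subseteq> homog_part V k"
      using subst_homog_part[of h V, OF h_homog] by blast
    show "homog_part V k \<subseteq> subst h ` homog_part UNIV k"
    proof
      fix p assume p: "p \<in> homog_part V k"
      then have "subst h p = p"
        by (intro subst_cong_vars[of _ V]) (auto simp: homog_part_def h_def V_def)
      moreover have "p \<in> homog_part UNIV k" using p by (simp add: homog_part_def)
      ultimately show "p \<in> subst h ` homog_part UNIV k" by (rule image_eqI[OF sym])
    qed
  qed
  have degrees: "\<phi> ` (\<lambda>p. Q +>\<^bsub>T\<^esub> p) ` homog_part UNIV k
      = (\<lambda>p. J +>\<^bsub>R\<^esub> sr_class V \<Delta> p) ` homog_part V k" for k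
    unfolding image_image \<phi>_class subst_image[symmetric] by (rule refl)
  have classes: "sr_class V \<Delta> (l q) \<in> carrier R" if "q \<in> {1..CARD('d) - card (nsupp v)}" for q
  proof -
    have "l q \<in> carrier (poly_ring V)"
      using S_homog homog_carrier that unfolding S_def by blast
    then show ?thesis
      unfolding sr_class_def R_def sr_ring_def
      by (rule ring_hom_closed[OF ideal.rcos_ring_hom[OF ideal_sr_ideal]])
  qed
  have "krull_dim R = complex_dim \<Delta> + 1"
    unfolding R_def
  proof (rule krull_dim_sr_ring)
    show "\<rho> \<in> \<Delta>" if "\<sigma> \<in> \<Delta>" "\<rho> \<subseteq> \<sigma>" for \<rho> \<sigma>
      using that unfolding \<Delta>_def by (rule link_down_closed)
    show "\<tau> \<subseteq> V" if "\<tau> \<in> \<Delta>" for \<tau>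
      using that by (auto simp: \<Delta>_def V_def link_iff)
  qed
  moreover have "complex_dim \<Delta> + 1 = ereal (real CARD('d) - real (card (nsupp v)))"
    if "\<exists>(a, \<sigma>) \<in> std_pairs_at A w v. card \<sigma> = CARD('d)"
    using that link_complex_dim[OF generic] by (auto simp: \<Delta>_def one_ereal_def)
  ultimately have dims: "(\<exists>(a, \<sigma>) \<in> std_pairs_at A w v. card \<sigma> = CARD('d)) \<longrightarrow>
      ereal (real CARD('d) - real (card (nsupp v))) = krull_dim R \<and> krull_dim R = complex_dim \<Delta> + 1"
    by metis
  show ?thesis
    unfolding Let_def V_def[symmetric] \<Delta>_def[symmetric] T_def[symmetric] Q_def[symmetric]
      R_def[symmetric] S_def[symmetric] J_def[symmetric]
    by (intro conjI bexI[of _ \<phi>] ballI allI) (fact classes \<phi> constants degrees dims)+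
qed

end
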